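(* For every $n\in\mathbb{N}$, every recurrent sandpile $\eta\in\mathcal{R}_n$ on the level-$n$ Vicsek graph $\mathcal{V}_n$ whose class $[\eta]$ is not the identity of the sandpile group satisfies $$\mathrm{ord}_{\mathcal{R}_n}([\eta])\in\{2,4\},$$ and moreover $$\mathcal{R}_n\cong \mathbb{Z}_4^{\,2\cdot 5^n},\qquad \mathbb{Z}_4=\mathbb{Z}/4\mathbb{Z}.$$
   Context: $\mathbb{N}=\{0,1,2,\dots\}$. **Vicsek graphs.** $\mathcal{V}_0=(V_0,E_0)$ is the complete graph on $V_0=\{(0,0),(1,0),(0,1),(1,1)\}$. For $n\ge 1$ put $L=3^{n-1}$ and let $S_n=\{(0,0),(L,L),(2L,0),(0,2L),(2L,2L)\}$. Then $\mathcal{V}_n=(V_n,E_n)$ with $V_n=\bigcup_{a\in S_n}(a+V_{n-1})$ and $E_n=\bigcup_{a\in S_n}(a+E_{n-1})$, where $a+\{v,w\}=\{a+v,a+w\}$ for an edge $\{v,w\}$. The sink of $\mathcal{V}_n$ is $s_n=(3^n,3^n)$. **Sandpiles on $\mathcal{V}_n$.** Write $V_n'=V_n\setminus\{s_n\}$. A sandpile on $\mathcal{V}_n$ is $\sigma:V_n'\to\mathbb{N}$; it is stable if $\sigma(v)<\deg(v)$ for all $v\in V_n'$. Toppling $v\in V_n'$ replaces $\sigma$ by $\sigma-\Delta\delta_v$, where $\Delta\in\mathbb{Z}^{V_n'\times V_n'}$ has entries $\Delta(x,x)=\deg(x)$, $\Delta(x,y)=-1$ if $x\sim y$, and $0$ otherwise;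 it is legal if $\sigma(v)\ge\deg(v)$. Every sandpile $\sigma$ is transformed by finitely many legal topplings into a unique stable sandpile $\sigma^\circ$. The sandpile Markov chain on stable sandpiles is $\sigma_{k+1}=(\sigma_k+\delta_{Y_{k+1}})^\circ$ with $Y_1,Y_2,\dots$ i.i.d. uniform on $V_n'$. Its set of recurrent states $\mathcal{R}_n$ is an Abelian group (the sandpile group) under $\eta\oplus\zeta=(\eta+\zeta)^\circ$, and $\eta\mapsto[\eta]$ is an isomorphism $\mathcal{R}_n\cong\mathbb{Z}^{V_n'}/\Delta\mathbb{Z}^{V_n'}$, where $[\eta]$ is the class of $\eta$. $\mathrm{ord}_{\mathcal{R}_n}([\eta])$ is the order of that group element. *)

theory Defs
  imports "HOL-Algebra.Algebra" "HOL-Probability.Probability" "HOL-Library.Product_Plus"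
begin

section \<open>Vicsek graphs\<close>

type_synonym vertex = "nat \<times> nat"

definition vicsek_shifts :: "nat \<Rightarrow> vertex set" where
  "vicsek_shifts L = {(0, 0), (L, L), (2 * L, 0), (0, 2 * L), (2 * L, 2 * L)}"

text \<open>With index \<open>Suc n\<close>, the translation length is \<open>3 ^ (Suc n - 1) = 3 ^ n\<close>.\<close>

primrec vicsek_verts :: "nat \<Rightarrow> vertex set" where
  "vicsek_verts 0 = {(0, 0), (1, 0), (0, 1), (1, 1)}"
| "vicsek_verts (Suc n) = (\<Union>a\<in>vicsek_shifts (3 ^ n). (\<lambda>v. a + v) ` vicsek_verts n)"

primrec vicsek_edges :: "nat \<Rightarrow> vertex set set" where
  "vicsek_edges 0 = {{v, w} | v w. v \<in> vicsek_verts 0 \<and> w \<in> vicsek_verts 0 \<and> v \<noteq> w}"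
| "vicsek_edges (Suc n) =
     (\<Union>a\<in>vicsek_shifts (3 ^ n). (\<lambda>e. (\<lambda>v. a + v) ` e) ` vicsek_edges n)"

definition vicsek_sink :: "nat \<Rightarrow> vertex" where
  "vicsek_sink n = (3 ^ n, 3 ^ n)"

definition nonsink :: "nat \<Rightarrow> vertex set" where
  "nonsink n = vicsek_verts n - {vicsek_sink n}"

text \<open>The degree is taken in the full graph, so edges to the sink count.\<close>

definition deg :: "nat \<Rightarrow> vertex \<Rightarrow> nat" where
  "deg n v = card {e \<in> vicsek_edges n. v \<in> e}"

definition laplacian :: "nat \<Rightarrow> vertex \<Rightarrow> vertex \<Rightarrow> int" where
  "laplacian n x y =
     (if x = y then int (deg n x) else if {x, y} \<in> vicsek_edges n then -1 else 0)"

section \<open>Sandpiles and stabilization\<close>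

text \<open>
  A function on the non-sink vertices is represented by the extensional function that is
  \<open>undefined\<close> elsewhere, in accordance with \<^const>\<open>PiE\<close> and \<^const>\<open>product_group\<close>.
\<close>

type_synonym sandpile = "vertex \<Rightarrow> nat"

definition sandpiles :: "nat \<Rightarrow> sandpile set" where
  "sandpiles n = nonsink n \<rightarrow>\<^sub>E UNIV"

definition stable :: "nat \<Rightarrow> sandpile \<Rightarrow> bool" where
  "stable n \<sigma> \<longleftrightarrow> \<sigma> \<in> sandpiles n \<and> (\<forall>v\<in>nonsink n. \<sigma> v < deg n v)"

text \<open>One legal toppling; the difference \<open>\<sigma> - \<Delta> \<delta>\<^sub>v\<close> is taken in the integers.\<close>

definition legal_topple :: "nat \<Rightarrow> sandpile \<Rightarrow> sandpile \<Rightarrow> bool" where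
  "legal_topple n \<sigma> \<sigma>' \<longleftrightarrow> \<sigma> \<in> sandpiles n \<and> \<sigma>' \<in> sandpiles n \<and>
     (\<exists>v\<in>nonsink n. deg n v \<le> \<sigma> v \<and>
        (\<forall>x\<in>nonsink n. int (\<sigma>' x) = int (\<sigma> x) - laplacian n x v))"

definition stabilize :: "nat \<Rightarrow> sandpile \<Rightarrow> sandpile" where
  "stabilize n \<sigma> = (THE \<tau>. stable n \<tau> \<and> (legal_topple n)\<^sup>*\<^sup>* \<sigma> \<tau>)"

definition add_pile :: "nat \<Rightarrow> sandpile \<Rightarrow> sandpile \<Rightarrow> sandpile" where
  "add_pile n \<eta> \<zeta> = (\<lambda>x\<in>nonsink n. \<eta> x + \<zeta> x)"

definition delta_pile :: "nat \<Rightarrow> vertex \<Rightarrow> sandpile" where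
  "delta_pile n v = (\<lambda>x\<in>nonsink n. if x = v then 1 else 0)"

section \<open>The sandpile Markov chain and its recurrent states\<close>

text \<open>
  The trajectory started at \<open>\<sigma>\<close> and driven by the sequence of added grains; the stream is
  indexed from 0, so \<open>Y !! k\<close> is the grain \<open>Y\<^sub>k\<^sub>+\<^sub>1\<close>.
\<close>

primrec chain :: "nat \<Rightarrow> sandpile \<Rightarrow> vertex stream \<Rightarrow> nat \<Rightarrow> sandpile" where
  "chain n \<sigma> Y 0 = \<sigma>"
| "chain n \<sigma> Y (Suc k) = stabilize n (add_pile n (chain n \<sigma> Y k) (delta_pile n (Y !! k)))"

text \<open>The law of an i.i.d. sequence of uniformly distributed non-sink vertices.\<close>

definition grains :: "nat \<Rightarrow> vertex stream measure" where
  "grains n = stream_space (measure_pmf (pmf_of_set (nonsink n)))"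

text \<open>A state is recurrent if the chain started there returns to it almost surely.\<close>

definition recurrent :: "nat \<Rightarrow> sandpile set" where
  "recurrent n = {\<eta>. stable n \<eta> \<and> (AE Y in grains n. \<exists>k\<ge>1. chain n \<eta> Y k = \<eta>)}"

section \<open>The sandpile group\<close>

definition sandpile_add :: "nat \<Rightarrow> sandpile \<Rightarrow> sandpile \<Rightarrow> sandpile" where
  "sandpile_add n \<eta> \<zeta> = stabilize n (add_pile n \<eta> \<zeta>)"

text \<open>The neutral element has no closed form; it is described by its universal property.\<close>

definition sandpile_group :: "nat \<Rightarrow> sandpile monoid" where
  "sandpile_group n = \<lparr>carrier = recurrent n, monoid.mult = sandpile_add n,
     monoid.one = (THE e. e \<in> recurrent n \<and>
       (\<forall>\<eta>\<in>recurrent n. sandpile_add n e \<eta> = \<eta> \<and> sandpile_add n \<eta> e = \<eta>))\<rparr>"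

definition config_group :: "nat \<Rightarrow> (vertex \<Rightarrow> int) monoid" where
  "config_group n = product_group (nonsink n) (\<lambda>_. integer_group)"

definition laplacian_image :: "nat \<Rightarrow> (vertex \<Rightarrow> int) set" where
  "laplacian_image n =
     (\<lambda>f. \<lambda>x\<in>nonsink n. \<Sum>y\<in>nonsink n. laplacian n x y * f y) ` carrier (config_group n)"

definition class_group :: "nat \<Rightarrow> (vertex \<Rightarrow> int) set monoid" where
  "class_group n = config_group n Mod laplacian_image n"

definition sandpile_class :: "nat \<Rightarrow> sandpile \<Rightarrow> (vertex \<Rightarrow> int) set" where
  "sandpile_class n \<eta> =
     laplacian_image n #>\<^bsub>config_group n\<^esub> (\<lambda>x\<in>nonsink n. int (\<eta> x))"

end

theory Submission
  imports Defs "HOL-Library.Confluence"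
begin

text \<open>
Two copies of \<open>\<V>\<^sub>n\<close> in \<open>\<V>\<^sub>n\<^sub>+\<^sub>1\<close> share at most one corner, so \<open>\<V>\<^sub>n\<close> consists of \<open>5\<^sup>n\<close> four-cliques
(cells) that are glued along cut vertices in a tree-like fashion. Rooting this tree of cells at the
sink, every cell has one vertex nearest to the sink and three private vertices \<open>a, b, c\<close>, and the
Laplacian is a sum of clique Laplacians, one per cell. In the differences along the cells as new
coordinates it becomes block diagonal, with one block \<open>4 I - J\<close> of size three per cell (\<open>J\<close> is the
all-ones matrix); such a block has cokernel \<open>\<int>\<^sub>4\<^sup>2\<close>. The dual change of coordinates replaces the
content of a vertex by the total content of the part of the graph that hangs below it.
\<open>clique_tree_mod4_coordinates\<close> carries this out by induction along the tree: a leaf cell is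
removed by pushing its content into its attaching vertex, and the two differences of the contents
of its private vertices, read modulo 4, are exactly what is lost. This yields \<open>2 \<cdot> 5\<^sup>n\<close> additive
coordinates which modulo 4 form a complete and independent system of invariants of the classes of
configurations modulo the Laplacian.

It remains to identify the recurrent states with these classes. Legal topplings commute, and they
terminate because there is a nonnegative potential with constant positive Laplacian; hence
stabilization is well defined and compatible with addition. The burning pile
\<open>\<epsilon> = u - u\<degree>\<close>, where \<open>u\<close> puts \<open>deg v\<close> grains on each vertex \<open>v\<close>, is positive everywhere, lies in
the image of the Laplacian, and is absorbed without trace by every sufficiently large pile. Each
class contains exactly one stable state \<open>\<eta>\<close> with \<open>(\<eta> + \<epsilon>)\<degree> = \<eta>\<close>
(\<open>lap_equiv_burning_invariant_exists\<close>, \<open>lap_equiv_burning_invariant_unique\<close>): the stabilization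
of a large representative is such a state, and two such states in one class become comparable by
legal topplings after adding a large multiple of \<open>\<epsilon>\<close>.

Finally, these states are the recurrent ones (\<open>recurrent_eq_burning_invariant\<close>). A recurrent
state is regained after any first grain \<open>v\<close>, hence is fixed by the addition of some pile that is
positive at \<open>v\<close>; combining these over all \<open>v\<close> shows that it is the stabilization of arbitrarily
large piles. Conversely, a state fixed by \<open>\<epsilon>\<close> can be reached from every stable state, and the maximum
principle for the probability of never hitting it shows that this probability is zero.
\<close>

section \<open>Trees of four-cliques\<close>

text \<open>
A graph that grows from the root \<open>s\<close> by attaching four-cliques \<open>{r, a, b, c}\<close>, each at one
existing vertex \<open>r\<close>. The set \<open>V\<close> collects the vertices other than the root, because only they carry
sandpile content when the root is the sink; \<open>\<C>\<close> collects the cliques.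
\<close>

inductive clique_tree :: "'a \<Rightarrow> 'a set \<Rightarrow> 'a set set \<Rightarrow> bool" where
  root: "clique_tree s {} {}"
| leaf: "clique_tree s (V \<union> {a, b, c}) (insert {r, a, b, c} \<C>)"
    if "clique_tree s V \<C>" "r \<in> insert s V" "{a, b, c} \<inter> insert s V = {}" "distinct [a, b, c]"

lemma clique_tree_finite: "clique_tree s V \<C> \<Longrightarrow> finite V \<and> finite \<C>"
  by (induction rule: clique_tree.induct) auto

lemma clique_tree_cell_subset: "clique_tree s V \<C> \<Longrightarrow> C \<in> \<C> \<Longrightarrow> C \<subseteq> insert s V"
  by (induction rule: clique_tree.induct) auto

lemma clique_tree_cell_card: "clique_tree s V \<C> \<Longrightarrow> C \<in> \<C> \<Longrightarrow> card C = 4"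
proof (induction rule: clique_tree.induct)
  case (leaf s V \<C> r a b c)
  moreover have "r \<noteq> a" "r \<noteq> b" "r \<noteq> c"
    using leaf.hyps by auto
  then have "card {r, a, b, c} = 4"
    using leaf.hyps by simp
  ultimately show ?case by auto
qed simp

text \<open>
At the moment a clique is attached it meets every older one in at most the attaching vertex.
Consequently no edge lies in two cells, so that vertex degrees are sums over the cells.
\<close>

lemma clique_tree_cells_meet_once:
  assumes "clique_tree s V \<C>" "C \<in> \<C>" "C' \<in> \<C>" "C \<noteq> C'" "x \<in> C \<inter> C'" "y \<in> C \<inter> C'"
  shows "x = y"
  using assms
proof (induction arbitrary: C C' rule: clique_tree.induct)
  case (leaf s V \<C> r a b c)
  have "B \<inter> {r, a, b, c} \<subseteq> {r}" if "B \<in> \<C>" for B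
    using clique_tree_cell_subset[OF leaf.hyps(1) that] leaf.hyps(3) by auto
  then show ?case
    using leaf.prems leaf.IH[of C C'] by (auto; blast)
qed simp

text \<open>
The second tree can be grown on top of the first one, since its fresh vertices remain fresh.
\<close>

lemma clique_tree_glue:
  assumes "clique_tree r V' \<C>'" "clique_tree s V \<C>" "r \<in> insert s V" "V' \<inter> insert s V = {}"
  shows "clique_tree s (V \<union> V') (\<C> \<union> \<C>')"
  using assms
proof (induction rule: clique_tree.induct)
  case (leaf r V' \<C>' q a b c)
  have "clique_tree s ((V \<union> V') \<union> {a, b, c}) (insert {q, a, b, c} (\<C> \<union> \<C>'))"
    by (rule clique_tree.leaf) (use leaf in auto)
  then show ?case by (simp add: Un_assoc)
qed simp

lemma clique_tree_image:
  assumes "clique_tree s V \<C>" "inj_on f (insert s V)"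
  shows "clique_tree (f s) (f ` V) ((`) f ` \<C>)"
  using assms
proof (induction rule: clique_tree.induct)
  case (leaf s V \<C> r a b c)
  have "clique_tree (f s) (f ` V \<union> {f a, f b, f c}) (insert {f r, f a, f b, f c} ((`) f ` \<C>))"
  proof (rule clique_tree.leaf)
    show "clique_tree (f s) (f ` V) ((`) f ` \<C>)"
      using leaf by (auto intro: inj_on_subset)
    show "{f a, f b, f c} \<inter> insert (f s) (f ` V) = {}"
      using leaf.hyps(3) leaf.prems by (auto simp: inj_on_def)
    show "distinct [f a, f b, f c]"
      using leaf.hyps(4) leaf.prems by (auto simp: inj_on_def)
  qed (use leaf.hyps(2) in auto)
  then show ?case by (simp add: image_Un)
qed (simp add: clique_tree.root)

lemma clique_tree_single:
  assumes "card C = 4" "s \<in> C"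
  shows "clique_tree s (C - {s}) {C}"
proof -
  have "card (C - {s}) = 3"
    using assms by simp
  then obtain a b c where abc: "C - {s} = {a, b, c}" "a \<noteq> b" "b \<noteq> c" "a \<noteq> c"
    by (auto simp: card_3_iff)
  have "clique_tree s ({} \<union> {a, b, c}) (insert {s, a, b, c} {})"
    by (rule clique_tree.leaf[OF clique_tree.root]) (use abc in auto)
  moreover have "{s, a, b, c} = C"
    using abc assms(2) by blast
  ultimately show ?thesis by (simp add: abc(1))
qed

text \<open>
Being such a tree does not depend on the root: to move the root into the last clique attached,
start with that clique and glue onto it the old tree, rerooted at the attaching vertex. This is
needed because the outer copies in a Vicsek graph are attached at four different corners.
\<close>

lemma clique_tree_reroot:
  assumes "clique_tree s V \<C>" "t \<in> insert s V"
  shows "clique_tree t (insert s V - {t}) \<C>"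
  using assms
proof (induction arbitrary: t rule: clique_tree.induct)
  case (root s)
  then show ?case by (auto intro: clique_tree.root)
next
  case (leaf s V \<C> r a b c)
  have "r \<noteq> a" "r \<noteq> b" "r \<noteq> c"
    using leaf.hyps by auto
  then have card: "card {r, a, b, c} = 4"
    using leaf.hyps by simp
  show ?case
  proof (cases "t \<in> insert s V")
    case True
    have "clique_tree t ((insert s V - {t}) \<union> {a, b, c}) (insert {r, a, b, c} \<C>)"
      by (rule clique_tree.leaf) (use leaf True in auto)
    moreover have "(insert s V - {t}) \<union> {a, b, c} = insert s (V \<union> {a, b, c}) - {t}"
      using True leaf.hyps(3) by auto
    ultimately show ?thesis by simp
  next
    case False
    then have t: "t \<in> {a, b, c}"
      using leaf.prems by auto
    have "clique_tree t (({r, a, b, c} - {t}) \<union> (insert s V - {r})) ({{r, a, b, c}} \<union> \<C>)"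
    proof (rule clique_tree_glue)
      show "clique_tree r (insert s V - {r}) \<C>"
        using leaf by auto
      show "clique_tree t ({r, a, b, c} - {t}) {{r, a, b, c}}"
        by (rule clique_tree_single[OF card]) (use t in auto)
    qed (use leaf.hyps t in auto)
    moreover have "({r, a, b, c} - {t}) \<union> (insert s V - {r}) = insert s (V \<union> {a, b, c}) - {t}"
      using t False leaf.hyps by auto
    ultimately show ?thesis by simp
  qed
qed

definition clique_tree_on :: "'a set \<Rightarrow> 'a set set \<Rightarrow> bool" where
  "clique_tree_on W \<C> \<longleftrightarrow> (\<exists>s\<in>W. clique_tree s (W - {s}) \<C>)"

lemma clique_tree_onD: "clique_tree_on W \<C> \<Longrightarrow> t \<in> W \<Longrightarrow> clique_tree t (W - {t}) \<C>"
  unfolding clique_tree_on_def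
  by (metis clique_tree_reroot insert_Diff)

text \<open>
Rooting both trees at the common vertex reduces this to gluing. A common cell would have to lie
inside the single common vertex, hence the numbers of cells add up.
\<close>

lemma clique_tree_on_union:
  assumes "clique_tree_on W \<C>" "clique_tree_on W' \<C>'" "W \<inter> W' = {r}"
  shows "clique_tree_on (W \<union> W') (\<C> \<union> \<C>') \<and> card (\<C> \<union> \<C>') = card \<C> + card \<C>'"
proof -
  have r: "r \<in> W" "r \<in> W'"
    using assms(3) by auto
  note t = clique_tree_onD[OF assms(1) r(1)] clique_tree_onD[OF assms(2) r(2)]
  have "clique_tree r ((W - {r}) \<union> (W' - {r})) (\<C> \<union> \<C>')"
    by (rule clique_tree_glue[OF t(2) t(1)]) (use assms(3) in auto)
  moreover have "(W - {r}) \<union> (W' - {r}) = (W \<union> W') - {r}"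
    by auto
  ultimately have "clique_tree_on (W \<union> W') (\<C> \<union> \<C>')"
    unfolding clique_tree_on_def using r by auto
  moreover have "\<C> \<inter> \<C>' = {}"
  proof (rule ccontr)
    assume "\<C> \<inter> \<C>' \<noteq> {}"
    then obtain C where C: "C \<in> \<C>" "C \<in> \<C>'"
      by auto
    have "C \<subseteq> {r}"
      using clique_tree_cell_subset[OF t(1) C(1)] clique_tree_cell_subset[OF t(2) C(2)] r assms(3)
      by auto
    then have "card C \<le> 1"
      using card_mono[of "{r}" C] by simp
    then show False
      using clique_tree_cell_card[OF t(1) C(1)] by simp
  qed
  ultimately show ?thesis
    using clique_tree_finite[OF t(1)] clique_tree_finite[OF t(2)] by (simp add: card_Un_disjoint)
qed

lemma clique_tree_on_image:
  assumes "clique_tree_on W \<C>" "inj_on f W"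
  shows "clique_tree_on (f ` W) ((`) f ` \<C>)"
proof -
  obtain s where s: "s \<in> W" "clique_tree s (W - {s}) \<C>"
    using assms(1) by (auto simp: clique_tree_on_def)
  have "insert s (W - {s}) = W"
    using s(1) by blast
  then have "clique_tree (f s) (f ` (W - {s})) ((`) f ` \<C>)"
    using clique_tree_image[OF s(2)] assms(2) by simp
  moreover have "f ` (W - {s}) = f ` W - {f s}"
    using s(1) assms(2) by (auto simp: inj_on_def)
  ultimately show ?thesis
    using s(1) by (auto simp: clique_tree_on_def)
qed

definition clique_edges :: "'a set \<Rightarrow> 'a set set" where
  "clique_edges C = {{v, w} | v w. v \<in> C \<and> w \<in> C \<and> v \<noteq> w}"

lemma pair_in_clique_edges: "{x, y} \<in> clique_edges C \<longleftrightarrow> x \<in> C \<and> y \<in> C \<and> x \<noteq> y"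
  by (auto simp: clique_edges_def doubleton_eq_iff)

lemma clique_edgesE:
  assumes "e \<in> clique_edges C" "x \<in> e"
  obtains y where "e = {x, y}"
  using assms by (auto simp: clique_edges_def)

lemma clique_edges_image:
  assumes "inj f"
  shows "(`) f ` clique_edges C = clique_edges (f ` C)"
proof (intro equalityI subsetI)
  fix e assume "e \<in> (`) f ` clique_edges C"
  then obtain v w where "v \<in> C" "w \<in> C" "v \<noteq> w" "e = {f v, f w}"
    by (auto simp: clique_edges_def)
  then show "e \<in> clique_edges (f ` C)"
    using assms by (auto simp: pair_in_clique_edges inj_eq)
next
  fix e assume "e \<in> clique_edges (f ` C)"
  then obtain v w where "v \<in> C" "w \<in> C" "v \<noteq> w" "e = {f v, f w}"
    by (auto simp: clique_edges_def)
  then show "e \<in> (`) f ` clique_edges C"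
    by (intro image_eqI[of _ _ "{v, w}"]) (auto simp: pair_in_clique_edges)
qed

section \<open>The cokernel of the Laplacian of a clique tree\<close>

text \<open>
The graph Laplacian, written as the sum of the Laplacians of the cells. The potential \<open>f\<close> is
defined on all vertices; grounding the sink amounts to \<open>f s = 0\<close>.
\<close>

definition cell_laplacian :: "'a set set \<Rightarrow> ('a \<Rightarrow> int) \<Rightarrow> 'a \<Rightarrow> int" where
  "cell_laplacian \<C> f v = (\<Sum>C\<in>{C \<in> \<C>. v \<in> C}. \<Sum>w\<in>C. f v - f w)"

lemma cell_laplacian_insert:
  assumes "finite \<C>" "C \<notin> \<C>"
  shows "cell_laplacian (insert C \<C>) f v =
    cell_laplacian \<C> f v + (if v \<in> C then \<Sum>w\<in>C. f v - f w else 0)"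
proof -
  have "{B \<in> insert C \<C>. v \<in> B} = (if v \<in> C then insert C {B \<in> \<C>. v \<in> B} else {B \<in> \<C>. v \<in> B})"
    by auto
  then show ?thesis
    using assms by (simp add: cell_laplacian_def)
qed

lemma cell_laplacian_cong:
  assumes "\<And>C. C \<in> \<C> \<Longrightarrow> C \<subseteq> W" "\<And>w. w \<in> W \<Longrightarrow> f w = g w"
  shows "cell_laplacian \<C> f v = cell_laplacian \<C> g v"
  unfolding cell_laplacian_def
  using assms by (intro sum.cong refl) (auto intro!: arg_cong2[of _ _ _ _ "(-)"])

lemma cell_laplacian_outside:
  assumes "\<And>C. C \<in> \<C> \<Longrightarrow> v \<notin> C"
  shows "cell_laplacian \<C> f v = 0"
  using assms by (auto simp: cell_laplacian_def intro: sum.neutral)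

lemma cell_laplacian_leaf:
  assumes "clique_tree s V \<C>" "r \<in> insert s V" "{a, b, c} \<inter> insert s V = {}" "distinct [a, b, c]"
  shows "cell_laplacian (insert {r, a, b, c} \<C>) f a = 3 * f a - f b - f c - f r"
    and "cell_laplacian (insert {r, a, b, c} \<C>) f b = 3 * f b - f a - f c - f r"
    and "cell_laplacian (insert {r, a, b, c} \<C>) f c = 3 * f c - f a - f b - f r"
    and "v \<in> insert s V \<Longrightarrow> cell_laplacian (insert {r, a, b, c} \<C>) f v =
      cell_laplacian \<C> f v + (if v = r then 3 * f r - f a - f b - f c else 0)"
proof -
  have sub: "C \<subseteq> insert s V" if "C \<in> \<C>" for C
    using clique_tree_cell_subset[OF assms(1) that] .
  have new: "{r, a, b, c} \<notin> \<C>" 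
    using sub assms(3) by blast
  have fin: "finite \<C>"
    using clique_tree_finite[OF assms(1)] by simp
  have out: "cell_laplacian \<C> f v = 0" if "v \<in> {a, b, c}" for v
    by (rule cell_laplacian_outside) (use sub that assms(3) in blast)
  have d: "a \<noteq> b" "a \<noteq> c" "b \<noteq> c" "r \<noteq> a" "r \<noteq> b" "r \<noteq> c"
    using assms by auto
  note ins = cell_laplacian_insert[OF fin new, of f]
  show "cell_laplacian (insert {r, a, b, c} \<C>) f a = 3 * f a - f b - f c - f r"
    "cell_laplacian (insert {r, a, b, c} \<C>) f b = 3 * f b - f a - f c - f r"
    "cell_laplacian (insert {r, a, b, c} \<C>) f c = 3 * f c - f a - f b - f r"
    using d by (auto simp: ins out)
  show "cell_laplacian (insert {r, a, b, c} \<C>) f v =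
      cell_laplacian \<C> f v + (if v = r then 3 * f r - f a - f b - f c else 0)" if "v \<in> insert s V"
    using d that assms(3) by (auto simp: ins)
qed

text \<open>
A system of additive integer coordinates, two per cell, that identifies the cokernel of the
Laplacian of a clique tree with a power of \<open>\<int>\<^sub>4\<close>. The coordinates of \<open>x\<close> are independent of its
values outside \<open>V\<close>, can be prescribed arbitrarily, and are all divisible by 4 exactly for the \<open>x\<close> in
the image of the Laplacian.
\<close>

locale mod4_coordinates =
  fixes s :: 'a and V :: "'a set" and \<C> :: "'a set set" and F :: "('a \<Rightarrow> int) \<Rightarrow> nat \<Rightarrow> int"
  assumes add: "F (\<lambda>v. x v + y v) i = F x i + F y i"
    and cong: "(\<And>v. v \<in> V \<Longrightarrow> x v = y v) \<Longrightarrow> F x i = F y i"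
    and surj: "\<exists>x. \<forall>i<2 * card \<C>. F x i = t i"
    and kernel: "(\<exists>f. f s = 0 \<and> (\<forall>v\<in>V. x v = cell_laplacian \<C> f v)) \<longleftrightarrow>
      (\<forall>i<2 * card \<C>. 4 dvd F x i)"

text \<open>
Let the clique \<open>{r, a, b, c}\<close> be attached last. At its private vertices the equation \<open>x = \<Delta> f\<close> reads
\<open>4 f v - f a - f b - f c - f r = x v\<close>. Adding the three equations gives
\<open>x a + x b + x c = f a + f b + f c - 3 f r\<close>, which is minus the contribution of the clique at \<open>r\<close>.
Hence \<open>f\<close> solves the equation on the smaller tree for the content in which the grains at \<open>a, b, c\<close>
have been pushed to \<open>r\<close>. Subtracting the equations shows that \<open>x a - x b\<close> and \<open>x b - x c\<close> are
multiples of 4; conversely, these two divisibilities allow to extend a solution on the smaller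
tree.
\<close>

theorem clique_tree_mod4_coordinates:
  "clique_tree s V \<C> \<Longrightarrow> \<exists>F. mod4_coordinates s V \<C> F"
proof (induction rule: clique_tree.induct)
  case (root s)
  have "mod4_coordinates s {} {} (\<lambda>x i. 0)"
    by unfold_locales auto
  then show ?case by blast
next
  case (leaf s V \<C> r a b c)
  then obtain F where "mod4_coordinates s V \<C> F"
    by blast
  then interpret IH: mod4_coordinates s V \<C> F .
  define m where "m = 2 * card \<C>"
  have sub: "C \<subseteq> insert s V" if "C \<in> \<C>" for C
    using clique_tree_cell_subset[OF leaf.hyps(1) that] .
  have "{r, a, b, c} \<notin> \<C>" 
    using sub leaf.hyps(3) by blast
  then have card: "2 * card (insert {r, a, b, c} \<C>) = Suc (Suc m)"
    using clique_tree_finite[OF leaf.hyps(1)] by (simp add: m_def)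
  have fresh: "a \<notin> insert s V" "b \<notin> insert s V" "c \<notin> insert s V" and
    dist: "a \<noteq> b" "a \<noteq> c" "b \<noteq> c" and r: "r \<in> insert s V"
    using leaf.hyps by auto
  note lap = cell_laplacian_leaf[OF leaf.hyps]
  define push where "push x = x(r := x r + x a + x b + x c)" for x :: "'a \<Rightarrow> int"
  define G where "G x i = (if i < m then F (push x) i else if i = m then x a - x b else x b - x c)"
    for x i
  have all_less: "(\<forall>i<Suc (Suc m). 4 dvd G x i) \<longleftrightarrow>
    (\<forall>i<m. 4 dvd F (push x) i) \<and> 4 dvd x a - x b \<and> 4 dvd x b - x c" for x
    by (auto simp: G_def less_Suc_eq all_conj_distrib)
  have "G (\<lambda>v. x v + y v) i = G x i + G y i" for x y i
  proof -
    have "push (\<lambda>v. x v + y v) = (\<lambda>v. push x v + push y v)"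
      by (auto simp: push_def)
    then show ?thesis
      by (auto simp: G_def IH.add)
  qed
  moreover have "G x i = G y i" if "\<And>v. v \<in> V \<union> {a, b, c} \<Longrightarrow> x v = y v" for x y i
  proof -
    have "F (push x) i = F (push y) i"
      by (rule IH.cong) (use that in \<open>auto simp: push_def\<close>)
    then show ?thesis
      using that by (auto simp: G_def)
  qed
  moreover have "\<exists>x. \<forall>i<Suc (Suc m). G x i = t i" for t
  proof -
    obtain x0 where x0: "\<And>i. i < m \<Longrightarrow> F x0 i = t i"
      using IH.surj m_def by metis
    \<comment> \<open>The last two coordinates fix the content of \<open>a, b, c\<close> up to a common summand; the content of
      \<open>r\<close> then compensates for what is pushed into it.\<close>
    define x where "x = x0(c := 0, b := t (Suc m), a := t m + t (Suc m),
      r := x0 r - (t m + t (Suc m) + t (Suc m)))"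
    have "F (push x) i = F x0 i" for i
      by (rule IH.cong) (use fresh dist r in \<open>auto simp: x_def push_def\<close>)
    then have "\<forall>i<Suc (Suc m). G x i = t i"
      using fresh dist r x0 by (auto simp: G_def x_def less_Suc_eq)
    then show ?thesis by blast
  qed
  moreover have "(\<exists>f. f s = 0 \<and>
        (\<forall>v\<in>V \<union> {a, b, c}. x v = cell_laplacian (insert {r, a, b, c} \<C>) f v)) \<longleftrightarrow>
      (\<forall>i<Suc (Suc m). 4 dvd G x i)" (is "?L \<longleftrightarrow> ?R") for x
  proof
    assume ?L
    then obtain f where f: "f s = 0"
      "\<And>v. v \<in> V \<union> {a, b, c} \<Longrightarrow> x v = cell_laplacian (insert {r, a, b, c} \<C>) f v"
      by blast
    have abc: "x a = 3 * f a - f b - f c - f r" "x b = 3 * f b - f a - f c - f r"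
      "x c = 3 * f c - f a - f b - f r"
      using f(2)[of a] f(2)[of b] f(2)[of c] lap(1-3)[of f] by auto
    have "push x v = cell_laplacian \<C> f v" if "v \<in> V" for v
      using f(2)[of v] that abc lap(4)[of v f] by (auto simp: push_def)
    then have "\<forall>i<m. 4 dvd F (push x) i"
      using IH.kernel[of "push x"] f(1) m_def by auto
    moreover have "x a - x b = 4 * (f a - f b)" "x b - x c = 4 * (f b - f c)"
      using abc by auto
    ultimately show ?R
      unfolding all_less by simp
  next
    assume ?R
    then have R: "\<forall>i<m. 4 dvd F (push x) i" "4 dvd x a - x b" "4 dvd x b - x c"
      unfolding all_less by auto
    obtain g where g: "g s = 0" "\<And>v. v \<in> V \<Longrightarrow> push x v = cell_laplacian \<C> g v"
      using IH.kernel[of "push x"] R(1) m_def by auto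
    obtain p q where pq: "x a - x b = 4 * p" "x b - x c = 4 * q"
      using R(2,3) by (auto elim!: dvdE)
    \<comment> \<open>With \<open>f b = f c + q\<close> and \<open>f a = f c + q + p\<close>, as the differences of the equations demand, the
      equation at \<open>c\<close> reads \<open>f c - 2 q - p - f r = x c\<close>.\<close>
    define fc where "fc = x c + 2 * q + p + g r"
    define f where "f = g(c := fc, b := fc + q, a := fc + q + p)"
    have f: "f a = fc + q + p" "f b = fc + q" "f c = fc" "f r = g r" "f s = 0"
      using fresh dist r g(1) by (auto simp: f_def)
    have cg: "cell_laplacian \<C> f v = cell_laplacian \<C> g v" for v
      by (rule cell_laplacian_cong[OF sub]) (use fresh in \<open>auto simp: f_def\<close>)
    have abc: "x a = 3 * f a - f b - f c - f r" "x b = 3 * f b - f a - f c - f r"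
      "x c = 3 * f c - f a - f b - f r"
      using pq unfolding f fc_def by auto
    have "x v = cell_laplacian (insert {r, a, b, c} \<C>) f v" if "v \<in> V \<union> {a, b, c}" for v
    proof (cases "v \<in> V")
      case True
      then show ?thesis
        using g(2)[OF True] lap(4)[of v f] abc by (auto simp: push_def cg split: if_splits)
    next
      case False
      then show ?thesis
        using that abc lap(1-3)[of f] by auto
    qed
    then show ?L
      using f(5) by blast
  qed
  ultimately have "mod4_coordinates s (V \<union> {a, b, c}) (insert {r, a, b, c} \<C>) G"
    unfolding mod4_coordinates_def card by blast
  then show ?case by blast
qed

section \<open>The Vicsek graph as a tree of four-cliques\<close>

primrec vicsek_cells :: "nat \<Rightarrow> vertex set set" where
  "vicsek_cells 0 = {vicsek_verts 0}"
| "vicsek_cells (Suc n) =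
     (\<Union>a\<in>vicsek_shifts (3 ^ n). (\<lambda>C. (\<lambda>v. a + v) ` C) ` vicsek_cells n)"

lemma vicsek_verts_bound: "v \<in> vicsek_verts n \<Longrightarrow> fst v \<le> 3 ^ n \<and> snd v \<le> 3 ^ n"
proof (induction n arbitrary: v)
  case (Suc n)
  then obtain a w where "a \<in> vicsek_shifts (3 ^ n)" "w \<in> vicsek_verts n" "v = a + w"
    by auto
  with Suc.IH[of w] show ?case
    by (auto simp: vicsek_shifts_def)
qed auto

lemma vicsek_corners:
  "(0, 0) \<in> vicsek_verts n" "(3 ^ n, 0) \<in> vicsek_verts n"
  "(0, 3 ^ n) \<in> vicsek_verts n" "(3 ^ n, 3 ^ n) \<in> vicsek_verts n"
proof (induction n)
  case (Suc n)
  have "a + v \<in> vicsek_verts (Suc n)" if "a \<in> vicsek_shifts (3 ^ n)" "v \<in> vicsek_verts n" for a v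
    using that by auto
  from this[of "(0, 0)" "(0, 0)"] this[of "(2 * 3 ^ n, 0)" "(3 ^ n, 0)"]
    this[of "(0, 2 * 3 ^ n)" "(0, 3 ^ n)"] this[of "(2 * 3 ^ n, 2 * 3 ^ n)" "(3 ^ n, 3 ^ n)"]
  show "(0, 0) \<in> vicsek_verts (Suc n)" "(3 ^ Suc n, 0) \<in> vicsek_verts (Suc n)"
    "(0, 3 ^ Suc n) \<in> vicsek_verts (Suc n)" "(3 ^ Suc n, 3 ^ Suc n) \<in> vicsek_verts (Suc n)"
    using Suc.IH by (simp_all add: vicsek_shifts_def del: vicsek_verts.simps)
qed auto

text \<open>
The central copy is glued to each of the four outer copies in one corner, and the bounding boxes
of the outer copies are pairwise disjoint.
\<close>

lemma vicsek_clique_tree: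
  "clique_tree_on (vicsek_verts n) (vicsek_cells n) \<and> card (vicsek_cells n) = 5 ^ n"
proof (induction n)
  case 0
  have "clique_tree (0, 0) (vicsek_verts 0 - {(0, 0)}) {vicsek_verts 0}"
    by (rule clique_tree_single) auto
  then show ?case
    by (auto simp: clique_tree_on_def)
next
  case (Suc n)
  define L :: nat where "L = 3 ^ n"
  have L: "L > 0" by (simp add: L_def)
  define W where "W a = (\<lambda>v. a + v) ` vicsek_verts n" for a
  define D where "D a = (`) (\<lambda>v. a + v) ` vicsek_cells n" for a :: vertex
  have tree: "clique_tree_on (W a) (D a)" for a
    unfolding W_def D_def using Suc.IH by (auto intro: clique_tree_on_image)
  have card: "card (D a) = 5 ^ n" for a
    unfolding D_def using Suc.IH
    by (subst card_image) (auto intro!: inj_onI simp: inj_image_eq_iff)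
  have bnd: "fst a \<le> fst p \<and> fst p \<le> fst a + L \<and> snd a \<le> snd p \<and> snd p \<le> snd a + L" if "p \<in> W a" for p a
    using that by (auto simp: W_def L_def dest: vicsek_verts_bound)
  have W: "(i + p, j + q) \<in> W (i, j)" if "(p, q) \<in> vicsek_verts n" for i j p q
    using imageI[OF that, of "\<lambda>v. (i, j) + v"] by (simp add: W_def)
  have corner: "(i, j) \<in> W (i, j)" "(i + L, j) \<in> W (i, j)" "(i, j + L) \<in> W (i, j)"
    "(i + L, j + L) \<in> W (i, j)" for i j
    using W[OF vicsek_corners(1)] W[OF vicsek_corners(2)] W[OF vicsek_corners(3)]
      W[OF vicsek_corners(4)] by (simp_all add: L_def)
  have corners: "(L, L) \<in> W (L, L)" "(L, 2 * L) \<in> W (L, L)" "(2 * L, L) \<in> W (L, L)"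
    "(2 * L, 2 * L) \<in> W (L, L)" "(L, L) \<in> W (0, 0)" "(2 * L, L) \<in> W (2 * L, 0)"
    "(L, 2 * L) \<in> W (0, 2 * L)" "(2 * L, 2 * L) \<in> W (2 * L, 2 * L)"
    using corner[of L L] corner[of 0 0] corner[of "2 * L" 0] corner[of 0 "2 * L"]
      corner[of "2 * L" "2 * L"] by (simp_all add: mult_2)
  have meet: "W (L, L) \<inter> W (0, 0) = {(L, L)}"
    "(W (L, L) \<union> W (0, 0)) \<inter> W (2 * L, 0) = {(2 * L, L)}"
    "(W (L, L) \<union> W (0, 0) \<union> W (2 * L, 0)) \<inter> W (0, 2 * L) = {(L, 2 * L)}"
    "(W (L, L) \<union> W (0, 0) \<union> W (2 * L, 0) \<union> W (0, 2 * L)) \<inter> W (2 * L, 2 * L) = {(2 * L, 2 * L)}"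
    using L by (auto simp: corners dest!: bnd)
  note u1 = clique_tree_on_union[OF tree tree meet(1)]
  note u2 = clique_tree_on_union[OF conjunct1[OF u1] tree meet(2)]
  note u3 = clique_tree_on_union[OF conjunct1[OF u2] tree meet(3)]
  note u4 = clique_tree_on_union[OF conjunct1[OF u3] tree meet(4)]
  have "vicsek_verts (Suc n) = W (L, L) \<union> W (0, 0) \<union> W (2 * L, 0) \<union> W (0, 2 * L) \<union> W (2 * L, 2 * L)"
    "vicsek_cells (Suc n) = D (L, L) \<union> D (0, 0) \<union> D (2 * L, 0) \<union> D (0, 2 * L) \<union> D (2 * L, 2 * L)"
    unfolding vicsek_verts.simps vicsek_cells.simps vicsek_shifts_def W_def D_def L_def
    by (simp_all only: UN_insert UN_empty Un_empty_left Un_empty_right Un_ac)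
  moreover have "card (D (L, L) \<union> D (0, 0) \<union> D (2 * L, 0) \<union> D (0, 2 * L) \<union> D (2 * L, 2 * L)) = 5 ^ Suc n"
    by (simp add: card u1 u2 u3 u4)
  ultimately show ?case
    using conjunct1[OF u4] by (simp only: simp_thms)
qed

lemma vicsek_sink_in: "vicsek_sink n \<in> vicsek_verts n"
  by (simp add: vicsek_sink_def vicsek_corners)

lemma insert_sink_nonsink: "insert (vicsek_sink n) (nonsink n) = vicsek_verts n"
  using vicsek_sink_in by (auto simp: nonsink_def)

lemma vicsek_clique_tree_sink: "clique_tree (vicsek_sink n) (nonsink n) (vicsek_cells n)"
  unfolding nonsink_def
  by (rule clique_tree_onD[OF conjunct1[OF vicsek_clique_tree] vicsek_sink_in])

lemma finite_nonsink [simp]: "finite (nonsink n)"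
  using clique_tree_finite[OF vicsek_clique_tree_sink] by simp

lemma nonsink_nonempty: "nonsink n \<noteq> {}"
proof -
  have "(0, 0) \<in> nonsink n"
    by (auto simp: nonsink_def vicsek_corners vicsek_sink_def)
  then show ?thesis by blast
qed

lemma vicsek_edges_cells: "vicsek_edges n = (\<Union>C\<in>vicsek_cells n. clique_edges C)"
proof (induction n)
  case 0
  then show ?case
    unfolding vicsek_edges.simps vicsek_cells.simps clique_edges_def
    by (simp only: UN_insert UN_empty Un_empty_right)
next
  case (Suc n)
  have "inj ((+) a)" for a :: vertex
    by (simp add: inj_def)
  then show ?case
    by (simp add: Suc.IH image_UN clique_edges_image) blast
qed

definition neighbours :: "nat \<Rightarrow> vertex \<Rightarrow> vertex set" where
  "neighbours n x = {y. {x, y} \<in> vicsek_edges n}"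

text \<open>
Reading neighbourhoods off the cells is what connects the degree, defined by counting edges, with
the Laplacian of the cells.
\<close>

lemma neighbours_cells: "neighbours n x = (\<Union>C\<in>{C \<in> vicsek_cells n. x \<in> C}. C - {x})"
proof -
  have "y \<in> neighbours n x \<longleftrightarrow> (\<exists>C\<in>vicsek_cells n. x \<in> C \<and> y \<in> C \<and> x \<noteq> y)" for y
    unfolding neighbours_def vicsek_edges_cells by (simp add: pair_in_clique_edges)
  then show ?thesis by blast
qed

lemma vicsek_cell_subset: "C \<in> vicsek_cells n \<Longrightarrow> C \<subseteq> vicsek_verts n"
  using clique_tree_cell_subset[OF vicsek_clique_tree_sink] insert_sink_nonsink by blast

lemma neighbours_subset: "neighbours n x \<subseteq> vicsek_verts n - {x}"
  using vicsek_cell_subset by (auto simp: neighbours_cells)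

lemma finite_neighbours [simp]: "finite (neighbours n x)"
  by (rule finite_subset[OF neighbours_subset]) (simp flip: insert_sink_nonsink)

lemma deg_eq_card_neighbours: "deg n x = card (neighbours n x)"
proof -
  have "{e \<in> vicsek_edges n. x \<in> e} = (\<lambda>y. {x, y}) ` neighbours n x"
  proof (intro equalityI subsetI)
    fix e assume e: "e \<in> {e \<in> vicsek_edges n. x \<in> e}"
    then obtain y where "e = {x, y}"
      by (auto simp: vicsek_edges_cells elim: clique_edgesE)
    with e show "e \<in> (\<lambda>y. {x, y}) ` neighbours n x"
      by (auto simp: neighbours_def)
  qed (auto simp: neighbours_def)
  moreover have "inj_on (\<lambda>y. {x, y}) (neighbours n x)"
    by (auto simp: inj_on_def doubleton_eq_iff)
  ultimately show ?thesis
    by (simp add: deg_def card_image)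
qed

lemma laplacian_sym: "laplacian n x y = laplacian n y x"
  by (auto simp: laplacian_def insert_commute)

text \<open>
The Laplacian with grounded sink, applied to a potential.
\<close>

definition lap :: "nat \<Rightarrow> (vertex \<Rightarrow> int) \<Rightarrow> vertex \<Rightarrow> int" where
  "lap n f x = (\<Sum>y\<in>nonsink n. laplacian n x y * f y)"

lemma lap_neighbours:
  assumes "x \<in> nonsink n" "f (vicsek_sink n) = 0"
  shows "lap n f x = (\<Sum>y\<in>neighbours n x. f x - f y)"
proof -
  have "lap n f x = laplacian n x x * f x + (\<Sum>y\<in>nonsink n - {x}. laplacian n x y * f y)"
    unfolding lap_def using assms(1) by (simp add: sum.remove)
  also have "(\<Sum>y\<in>nonsink n - {x}. laplacian n x y * f y) = (\<Sum>y\<in>neighbours n x. - f y)"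
  proof (rule sum.mono_neutral_cong)
    fix y assume "y \<in> neighbours n x - (nonsink n - {x})"
    then have "y = vicsek_sink n"
      using neighbours_subset[of n x] by (auto simp: nonsink_def)
    then show "- f y = 0" using assms(2) by simp
  qed (use finite_neighbours[of n x] in \<open>auto simp: laplacian_def neighbours_def\<close>)
  also have "laplacian n x x * f x = (\<Sum>y\<in>neighbours n x. f x)"
    by (simp add: laplacian_def deg_eq_card_neighbours)
  finally show ?thesis
    by (simp add: sum_subtractf sum_negf)
qed

lemma lap_cells:
  assumes "x \<in> nonsink n" "f (vicsek_sink n) = 0"
  shows "lap n f x = cell_laplacian (vicsek_cells n) f x"
proof -
  note tree = vicsek_clique_tree_sink[of n]
  have fin: "finite C" if "C \<in> vicsek_cells n" for C
    using clique_tree_cell_card[OF tree that] card.infinite by fastforce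
  have "lap n f x = (\<Sum>C\<in>{C \<in> vicsek_cells n. x \<in> C}. \<Sum>y\<in>C - {x}. f x - f y)"
    unfolding lap_neighbours[of x n f, OF assms] neighbours_cells
  proof (rule sum.UNION_disjoint)
    show "\<forall>C\<in>{C \<in> vicsek_cells n. x \<in> C}. \<forall>C'\<in>{C \<in> vicsek_cells n. x \<in> C}.
        C \<noteq> C' \<longrightarrow> (C - {x}) \<inter> (C' - {x}) = {}"
      using clique_tree_cells_meet_once[OF tree] by blast
  qed (use clique_tree_finite[OF tree] fin in auto)
  also have "\<dots> = cell_laplacian (vicsek_cells n) f x"
    unfolding cell_laplacian_def
    by (intro sum.cong refl sum.mono_neutral_left) (use fin in auto)
  finally show ?thesis .
qed

section \<open>Laplacian equivalence\<close>

lemma laplacian_diag: "laplacian n x x = int (deg n x)"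
  by (simp add: laplacian_def)

lemma laplacian_offdiag: "x \<noteq> y \<Longrightarrow> laplacian n x y \<le> 0"
  by (simp add: laplacian_def)

lemma lap_add: "lap n (\<lambda>v. f v + g v) x = lap n f x + lap n g x"
  by (simp add: lap_def distrib_left sum.distrib)

lemma lap_diff: "lap n (\<lambda>v. f v - g v) x = lap n f x - lap n g x"
  by (simp add: lap_def right_diff_distrib sum_subtractf)

lemma lap_cong: "(\<And>v. v \<in> nonsink n \<Longrightarrow> f v = g v) \<Longrightarrow> lap n f x = lap n g x"
  unfolding lap_def by (rule sum.cong) auto

lemma lap_single: "v \<in> nonsink n \<Longrightarrow> lap n (\<lambda>y. if y = v then 1 else 0) x = laplacian n x v"
  by (simp add: lap_def if_distrib cong: if_cong)

text \<open>
Congruence modulo the image of the reduced Laplacian, for functions that need not be extensional.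
\<close>

definition lap_equiv :: "nat \<Rightarrow> (vertex \<Rightarrow> int) \<Rightarrow> (vertex \<Rightarrow> int) \<Rightarrow> bool" where
  "lap_equiv n x y \<longleftrightarrow> (\<exists>f. \<forall>v\<in>nonsink n. x v - y v = lap n f v)"

lemma lap_equiv_refl: "(\<And>v. v \<in> nonsink n \<Longrightarrow> x v = y v) \<Longrightarrow> lap_equiv n x y"
  unfolding lap_equiv_def by (rule exI[of _ "\<lambda>v. 0"]) (simp add: lap_def)

lemma lap_equiv_sym: "lap_equiv n x y \<Longrightarrow> lap_equiv n y x"
proof -
  assume "lap_equiv n x y"
  then obtain f where f: "\<And>v. v \<in> nonsink n \<Longrightarrow> x v - y v = lap n f v"
    by (auto simp: lap_equiv_def)
  have "y v - x v = lap n (\<lambda>v. 0 - f v) v" if "v \<in> nonsink n" for v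
    using f[OF that] unfolding lap_diff by (simp add: lap_def)
  then show ?thesis
    unfolding lap_equiv_def by blast
qed

lemma lap_equiv_trans: "lap_equiv n x y \<Longrightarrow> lap_equiv n y z \<Longrightarrow> lap_equiv n x z"
proof -
  assume "lap_equiv n x y" "lap_equiv n y z"
  then obtain f g where fg: "\<And>v. v \<in> nonsink n \<Longrightarrow> x v - y v = lap n f v"
    "\<And>v. v \<in> nonsink n \<Longrightarrow> y v - z v = lap n g v"
    by (auto simp: lap_equiv_def)
  have "x v - z v = lap n (\<lambda>v. f v + g v) v" if "v \<in> nonsink n" for v
    using fg[OF that] unfolding lap_add by simp
  then show ?thesis
    unfolding lap_equiv_def by blast
qed

abbreviation vicsek_coordinates :: "nat \<Rightarrow> ((vertex \<Rightarrow> int) \<Rightarrow> nat \<Rightarrow> int) \<Rightarrow> bool" where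
  "vicsek_coordinates n \<equiv> mod4_coordinates (vicsek_sink n) (nonsink n) (vicsek_cells n)"

lemma lap_equiv_iff_coordinates:
  assumes "vicsek_coordinates n F"
  shows "lap_equiv n x y \<longleftrightarrow> (\<forall>i<2 * 5 ^ n. F x i mod 4 = F y i mod 4)"
proof -
  interpret mod4_coordinates "vicsek_sink n" "nonsink n" "vicsek_cells n" F
    by fact
  have sink: "vicsek_sink n \<notin> nonsink n"
    by (simp add: nonsink_def)
  have "lap_equiv n x y \<longleftrightarrow>
      (\<exists>f. f (vicsek_sink n) = 0 \<and> (\<forall>v\<in>nonsink n. x v - y v = lap n f v))" (is "_ = ?R")
  proof
    assume "lap_equiv n x y"
    then obtain f where f: "\<forall>v\<in>nonsink n. x v - y v = lap n f v"
      by (auto simp: lap_equiv_def)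
    have "lap n (f(vicsek_sink n := 0)) v = lap n f v" for v
      by (rule lap_cong) (use sink in auto)
    with f show ?R
      by (intro exI[of _ "f(vicsek_sink n := 0)"]) simp
  qed (auto simp: lap_equiv_def)
  also have "\<dots> \<longleftrightarrow> (\<exists>f. f (vicsek_sink n) = 0 \<and>
      (\<forall>v\<in>nonsink n. x v - y v = cell_laplacian (vicsek_cells n) f v))"
    by (simp add: lap_cells cong: conj_cong)
  also have "\<dots> \<longleftrightarrow> (\<forall>i<2 * 5 ^ n. 4 dvd F (\<lambda>v. x v - y v) i)"
    using kernel[of "\<lambda>v. x v - y v"] vicsek_clique_tree[of n] by simp
  also have "\<dots> \<longleftrightarrow> (\<forall>i<2 * 5 ^ n. F x i mod 4 = F y i mod 4)"
  proof -
    have "F x i = F (\<lambda>v. x v - y v) i + F y i" for i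
      using add[of "\<lambda>v. x v - y v" y i] by simp
    then show ?thesis
      by (simp add: mod_eq_dvd_iff)
  qed
  finally show ?thesis .
qed

lemma vicsek_coordinates_exist: "\<exists>F. vicsek_coordinates n F"
  by (rule clique_tree_mod4_coordinates[OF vicsek_clique_tree_sink])

lemma four_times_lap_equiv_zero: "lap_equiv n (\<lambda>v. 4 * x v) (\<lambda>v. 0)"
proof -
  obtain F where F: "vicsek_coordinates n F"
    using vicsek_coordinates_exist by blast
  then interpret mod4_coordinates "vicsek_sink n" "nonsink n" "vicsek_cells n" F .
  have "(\<lambda>v. 4 * x v) = (\<lambda>v. (x v + x v) + (x v + x v))"
    by auto
  then have "F (\<lambda>v. 4 * x v) i = 4 * F x i" for i
    using add[of "\<lambda>v. x v + x v" "\<lambda>v. x v + x v" i] add[of x x i] by simp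
  moreover have "F (\<lambda>v. 0) i = 0" for i
    using add[of "\<lambda>v. 0" "\<lambda>v. 0" i] by simp
  ultimately show ?thesis
    by (simp add: lap_equiv_iff_coordinates[OF F])
qed

text \<open>
Since 4 annihilates the cokernel, the constant 4 has an integral potential. At a non-sink minimum
its Laplacian would be nonpositive, so the minimum is attained at the sink, where the potential
vanishes. This potential is the Lyapunov function that makes toppling terminate.
\<close>

lemma nonneg_potential:
  obtains h where "\<And>v. h v \<ge> 0" "\<And>v. v \<in> nonsink n \<Longrightarrow> lap n h v = 4"
proof -
  obtain f where f: "\<And>v. v \<in> nonsink n \<Longrightarrow> lap n f v = 4"
    using four_times_lap_equiv_zero[of n "\<lambda>v. 1"] unfolding lap_equiv_def by auto
  define h where "h = (\<lambda>v. if v \<in> nonsink n then f v else 0)"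
  have h: "lap n h v = 4" if "v \<in> nonsink n" for v
    using f[OF that] lap_cong[of n h f v] by (simp add: h_def)
  have sink: "h (vicsek_sink n) = 0"
    by (simp add: h_def nonsink_def)
  have fin: "finite (h ` vicsek_verts n)"
    by (simp flip: insert_sink_nonsink)
  have ne: "h ` vicsek_verts n \<noteq> {}"
    using vicsek_sink_in by blast
  obtain v where v: "v \<in> vicsek_verts n" "Min (h ` vicsek_verts n) = h v"
    using Min_in[OF fin ne] by auto
  then have min: "h v \<le> h y" if "y \<in> vicsek_verts n" for y
    using Min_le[OF fin] that by fastforce
  have "v = vicsek_sink n"
  proof (rule ccontr)
    assume "v \<noteq> vicsek_sink n"
    then have "v \<in> nonsink n"
      using v(1) by (simp add: nonsink_def)
    moreover have "(\<Sum>y\<in>neighbours n v. h v - h y) \<le> 0"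
      by (rule sum_nonpos) (use neighbours_subset[of n v] min in auto)
    ultimately show False
      using h[of v] lap_neighbours[of v n h] sink by simp
  qed
  then have "h y \<ge> 0" for y
    using min[of y] sink by (cases "y \<in> vicsek_verts n") (auto simp: h_def nonsink_def)
  then show ?thesis
    using that h by blast
qed

section \<open>Stabilization\<close>

lemma sandpile_eqI:
  "\<sigma> \<in> sandpiles n \<Longrightarrow> \<tau> \<in> sandpiles n \<Longrightarrow> (\<And>x. x \<in> nonsink n \<Longrightarrow> \<sigma> x = \<tau> x) \<Longrightarrow> \<sigma> = \<tau>"
  unfolding sandpiles_def by (rule PiE_ext)

lemma restrict_sandpile [simp]: "restrict \<sigma> (nonsink n) \<in> sandpiles n"
  by (simp add: sandpiles_def)

lemma stable_sandpile: "stable n \<sigma> \<Longrightarrow> \<sigma> \<in> sandpiles n"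
  by (simp add: stable_def)

text \<open>
The toppling map, in a form that is total; for a legal toppling the truncation to \<open>nat\<close> has no
effect.
\<close>

definition topple :: "nat \<Rightarrow> vertex \<Rightarrow> sandpile \<Rightarrow> sandpile" where
  "topple n v \<sigma> = (\<lambda>x\<in>nonsink n. nat (int (\<sigma> x) - laplacian n x v))"

lemma topple_sandpile [simp]: "topple n v \<sigma> \<in> sandpiles n"
  by (simp add: topple_def)

lemma topple_apply:
  assumes "deg n v \<le> \<sigma> v" "x \<in> nonsink n"
  shows "int (topple n v \<sigma> x) = int (\<sigma> x) - laplacian n x v"
  using assms laplacian_offdiag[of x v n] by (cases "x = v") (auto simp: topple_def laplacian_diag)

lemma topple_mono_other:
  assumes "x \<in> nonsink n" "x \<noteq> v"
  shows "\<sigma> x \<le> topple n v \<sigma> x"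
  using assms laplacian_offdiag[of x v n] by (auto simp: topple_def)

lemma legal_topple_iff:
  "legal_topple n \<sigma> \<tau> \<longleftrightarrow>
    \<sigma> \<in> sandpiles n \<and> (\<exists>v\<in>nonsink n. deg n v \<le> \<sigma> v \<and> \<tau> = topple n v \<sigma>)"
proof
  assume "legal_topple n \<sigma> \<tau>"
  then obtain v where v: "\<sigma> \<in> sandpiles n" "\<tau> \<in> sandpiles n" "v \<in> nonsink n" "deg n v \<le> \<sigma> v"
    "\<And>x. x \<in> nonsink n \<Longrightarrow> int (\<tau> x) = int (\<sigma> x) - laplacian n x v"
    by (auto simp: legal_topple_def)
  have "\<tau> = topple n v \<sigma>"
    by (rule sandpile_eqI[OF v(2) topple_sandpile]) (use v in \<open>simp add: topple_def flip: v(5)\<close>)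
  then show "\<sigma> \<in> sandpiles n \<and> (\<exists>v\<in>nonsink n. deg n v \<le> \<sigma> v \<and> \<tau> = topple n v \<sigma>)"
    using v by blast
next
  assume "\<sigma> \<in> sandpiles n \<and> (\<exists>v\<in>nonsink n. deg n v \<le> \<sigma> v \<and> \<tau> = topple n v \<sigma>)"
  then show "legal_topple n \<sigma> \<tau>"
    unfolding legal_topple_def using topple_apply topple_sandpile by blast
qed

lemma legal_topplings_sandpile:
  "(legal_topple n)\<^sup>*\<^sup>* \<sigma> \<tau> \<Longrightarrow> \<sigma> \<in> sandpiles n \<Longrightarrow> \<tau> \<in> sandpiles n"
  by (induction rule: rtranclp_induct) (auto simp: legal_topple_def)

lemma topple_commute:
  assumes "v \<noteq> w" "v \<in> nonsink n" "w \<in> nonsink n" "deg n v \<le> \<sigma> v" "deg n w \<le> \<sigma> w"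
  shows "topple n w (topple n v \<sigma>) = topple n v (topple n w \<sigma>)"
proof (rule sandpile_eqI)
  fix x assume x: "x \<in> nonsink n"
  have "deg n w \<le> topple n v \<sigma> w" "deg n v \<le> topple n w \<sigma> v"
    using topple_mono_other[of w n v \<sigma>] topple_mono_other[of v n w \<sigma>] assms by auto
  then have "int (topple n w (topple n v \<sigma>) x) = int (topple n v (topple n w \<sigma>) x)"
    using assms x by (simp add: topple_apply)
  then show "topple n w (topple n v \<sigma>) x = topple n v (topple n w \<sigma>) x"
    by simp
qed auto

text \<open>
Toppling one vertex never takes grains from another one, so two legal topplings at different
vertices can be done in either order and with the same result.
\<close>

lemma confluent_legal_topple: "confluentp (legal_topple n)"
proof (rule strong_confluentp_imp_confluentp, rule strong_confluentpI)
  fix \<sigma> \<tau> \<rho> assume "legal_topple n \<sigma> \<tau>" "legal_topple n \<sigma> \<rho>"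
  then obtain v w where vw: "\<sigma> \<in> sandpiles n" "v \<in> nonsink n" "w \<in> nonsink n"
    "deg n v \<le> \<sigma> v" "deg n w \<le> \<sigma> w" "\<tau> = topple n v \<sigma>" "\<rho> = topple n w \<sigma>"
    by (auto simp: legal_topple_iff)
  show "\<exists>\<upsilon>. (legal_topple n)\<^sup>*\<^sup>* \<tau> \<upsilon> \<and> (legal_topple n)\<^sup>=\<^sup>= \<rho> \<upsilon>"
  proof (cases "v = w")
    case True
    then show ?thesis using vw by auto
  next
    case False
    have "legal_topple n \<tau> (topple n w \<tau>)" "legal_topple n \<rho> (topple n v \<rho>)"
      using vw False topple_mono_other[of w n v \<sigma>] topple_mono_other[of v n w \<sigma>]
      by (auto simp: legal_topple_iff intro: order_trans)
    moreover have "topple n w \<tau> = topple n v \<rho>"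
      using topple_commute False vw by simp
    ultimately show ?thesis by auto
  qed
qed

text \<open>
By symmetry of the Laplacian, each legal toppling lowers the total potential energy of the grains
by exactly 4, while this energy stays nonnegative.
\<close>

lemma stable_reachable:
  assumes "\<sigma> \<in> sandpiles n"
  shows "\<exists>\<tau>. stable n \<tau> \<and> (legal_topple n)\<^sup>*\<^sup>* \<sigma> \<tau>"
proof -
  obtain h where h: "\<And>v. h v \<ge> 0" "\<And>v. v \<in> nonsink n \<Longrightarrow> lap n h v = 4"
    using nonneg_potential by blast
  define weight where "weight \<sigma> = (\<Sum>x\<in>nonsink n. h x * int (\<sigma> x))" for \<sigma>
  have weight_nonneg: "weight \<sigma> \<ge> 0" for \<sigma>
    unfolding weight_def by (rule sum_nonneg) (simp add: h(1))
  show ?thesis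
    using assms
  proof (induction "nat (weight \<sigma>)" arbitrary: \<sigma> rule: less_induct)
    case less
    show ?case
    proof (cases "stable n \<sigma>")
      case False
      then obtain v where v: "v \<in> nonsink n" "deg n v \<le> \<sigma> v"
        using less.prems by (auto simp: stable_def not_less)
      have "weight (topple n v \<sigma>) = (\<Sum>x\<in>nonsink n. h x * int (\<sigma> x) - laplacian n v x * h x)"
        unfolding weight_def
        by (rule sum.cong) (auto simp: topple_apply v(2) algebra_simps laplacian_sym[of n v])
      also have "\<dots> = weight \<sigma> - 4"
        using h(2)[OF v(1)] by (simp add: sum_subtractf weight_def lap_def)
      finally have "nat (weight (topple n v \<sigma>)) < nat (weight \<sigma>)"
        using weight_nonneg[of "topple n v \<sigma>"] by linarith
      from less.hyps[OF this topple_sandpile]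
      obtain \<tau> where "stable n \<tau>" "(legal_topple n)\<^sup>*\<^sup>* (topple n v \<sigma>) \<tau>"
        by blast
      moreover have "legal_topple n \<sigma> (topple n v \<sigma>)"
        using less.prems v by (auto simp: legal_topple_iff)
      ultimately show ?thesis
        by (meson converse_rtranclp_into_rtranclp)
    qed auto
  qed
qed

lemma stable_no_topple: "stable n \<sigma> \<Longrightarrow> (legal_topple n)\<^sup>*\<^sup>* \<sigma> \<tau> \<Longrightarrow> \<tau> = \<sigma>"
  by (erule converse_rtranclpE) (auto simp: stable_def legal_topple_iff not_less[symmetric])

lemma stabilize_eqI:
  assumes "stable n \<tau>" "(legal_topple n)\<^sup>*\<^sup>* \<sigma> \<tau>"
  shows "stabilize n \<sigma> = \<tau>"
  unfolding stabilize_def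
proof (rule the_equality)
  fix \<rho> assume "stable n \<rho> \<and> (legal_topple n)\<^sup>*\<^sup>* \<sigma> \<rho>"
  then show "\<rho> = \<tau>"
    using confluentpD[OF confluent_legal_topple assms(2), of \<rho>] assms(1) stable_no_topple by metis
qed (use assms in auto)

lemma stable_stabilize: "\<sigma> \<in> sandpiles n \<Longrightarrow> stable n (stabilize n \<sigma>)"
  and stabilize_reachable: "\<sigma> \<in> sandpiles n \<Longrightarrow> (legal_topple n)\<^sup>*\<^sup>* \<sigma> (stabilize n \<sigma>)"
  using stable_reachable stabilize_eqI by metis+

lemma stabilize_sandpile [simp]: "\<sigma> \<in> sandpiles n \<Longrightarrow> stabilize n \<sigma> \<in> sandpiles n"
  using stable_stabilize stable_sandpile by blast

lemma stabilize_stable: "stable n \<sigma> \<Longrightarrow> stabilize n \<sigma> = \<sigma>"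
  by (rule stabilize_eqI) auto

lemma stabilize_topplings:
  assumes "(legal_topple n)\<^sup>*\<^sup>* \<sigma> \<tau>" "\<sigma> \<in> sandpiles n"
  shows "stabilize n \<sigma> = stabilize n \<tau>"
proof (rule stabilize_eqI)
  have "\<tau> \<in> sandpiles n"
    using legal_topplings_sandpile[OF assms] .
  then show "stable n (stabilize n \<tau>)" "(legal_topple n)\<^sup>*\<^sup>* \<sigma> (stabilize n \<tau>)"
    using stable_stabilize stabilize_reachable assms(1) rtranclp_trans by metis+
qed

lemma add_pile_sandpile [simp]: "add_pile n \<sigma> \<tau> \<in> sandpiles n"
  by (simp add: add_pile_def)

lemma add_pile_apply [simp]: "x \<in> nonsink n \<Longrightarrow> add_pile n \<sigma> \<tau> x = \<sigma> x + \<tau> x"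
  by (simp add: add_pile_def)

lemma add_pile_assoc: "add_pile n (add_pile n \<sigma> \<tau>) \<rho> = add_pile n \<sigma> (add_pile n \<tau> \<rho>)"
  by (auto simp: add_pile_def restrict_def)

lemma add_pile_commute: "add_pile n \<sigma> \<tau> = add_pile n \<tau> \<sigma>"
  by (auto simp: add_pile_def restrict_def)

lemma legal_topple_add:
  assumes "legal_topple n \<sigma> \<tau>"
  shows "legal_topple n (add_pile n \<sigma> \<zeta>) (add_pile n \<tau> \<zeta>)"
proof -
  obtain v where v: "v \<in> nonsink n" "deg n v \<le> \<sigma> v"
    "\<And>x. x \<in> nonsink n \<Longrightarrow> int (\<tau> x) = int (\<sigma> x) - laplacian n x v"
    using assms by (auto simp: legal_topple_def)
  then show ?thesis
    unfolding legal_topple_def by (auto intro!: bexI[of _ v])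
qed

lemma legal_topplings_add:
  "(legal_topple n)\<^sup>*\<^sup>* \<sigma> \<tau> \<Longrightarrow> (legal_topple n)\<^sup>*\<^sup>* (add_pile n \<sigma> \<zeta>) (add_pile n \<tau> \<zeta>)"
  by (induction rule: rtranclp_induct) (auto intro: legal_topple_add rtranclp.rtrancl_into_rtrancl)

text \<open>
Topplings that are legal remain legal after adding grains; therefore a summand may be stabilized
first. This is the abelian property used throughout.
\<close>

lemma stabilize_add:
  "\<sigma> \<in> sandpiles n \<Longrightarrow> stabilize n (add_pile n (stabilize n \<sigma>) \<zeta>) = stabilize n (add_pile n \<sigma> \<zeta>)"
  by (rule stabilize_topplings[symmetric])
    (auto intro: legal_topplings_add stabilize_reachable)

lemma legal_topplings_lap_equiv:
  assumes "(legal_topple n)\<^sup>*\<^sup>* \<sigma> \<tau>"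
  shows "lap_equiv n (\<lambda>v. int (\<sigma> v)) (\<lambda>v. int (\<tau> v))"
  using assms
proof (induction rule: rtranclp_induct)
  case base
  show ?case by (rule lap_equiv_refl) simp
next
  case (step \<tau> \<rho>)
  then obtain v where v: "v \<in> nonsink n" 
    "\<And>x. x \<in> nonsink n \<Longrightarrow> int (\<rho> x) = int (\<tau> x) - laplacian n x v"
    by (auto simp: legal_topple_def)
  then have "lap_equiv n (\<lambda>v. int (\<tau> v)) (\<lambda>v. int (\<rho> v))"
    unfolding lap_equiv_def
    by (intro exI[of _ "\<lambda>y. if y = v then 1 else 0"]) (simp add: lap_single)
  with step.IH show ?case
    by (rule lap_equiv_trans)
qed

lemma stabilize_lap_equiv:
  "\<sigma> \<in> sandpiles n \<Longrightarrow> lap_equiv n (\<lambda>v. int (\<sigma> v)) (\<lambda>v. int (stabilize n \<sigma> v))"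
  by (rule legal_topplings_lap_equiv[OF stabilize_reachable])

text \<open>
If every vertex initially holds enough grains for all its planned topplings, then they are legal in
any order, because toppling elsewhere only adds grains.
\<close>

lemma legal_multiple_toppling:
  assumes "\<sigma> \<in> sandpiles n" "\<And>x. x \<in> nonsink n \<Longrightarrow> deg n x * g x \<le> \<sigma> x"
  shows "(legal_topple n)\<^sup>*\<^sup>* \<sigma> (\<lambda>x\<in>nonsink n. nat (int (\<sigma> x) - lap n (\<lambda>v. int (g v)) x))"
  using assms
proof (induction "\<Sum>x\<in>nonsink n. g x" arbitrary: g \<sigma>)
  case 0
  then have "lap n (\<lambda>v. int (g v)) x = 0" for x
    by (simp add: lap_def)
  then have "(\<lambda>x\<in>nonsink n. nat (int (\<sigma> x) - lap n (\<lambda>v. int (g v)) x)) = \<sigma>"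
    by (intro sandpile_eqI[of _ n]) (use 0 in auto)
  then show ?case by simp
next
  case (Suc k)
  have "\<exists>v\<in>nonsink n. g v \<noteq> 0"
  proof (rule ccontr)
    assume "\<not> ?thesis"
    then have "(\<Sum>x\<in>nonsink n. g x) = 0" by simp
    with Suc.hyps(2) show False by simp
  qed
  then obtain v where v: "v \<in> nonsink n" "g v > 0"
    by auto
  have "deg n v \<le> deg n v * g v"
    using v(2) by (cases "g v") auto
  then have legal: "deg n v \<le> \<sigma> v"
    using Suc.prems(2)[OF v(1)] by (rule order_trans)
  define g' where "g' = g(v := g v - 1)"
  have "(\<Sum>x\<in>nonsink n. g x) = g v + (\<Sum>x\<in>nonsink n - {v}. g x)"
    "(\<Sum>x\<in>nonsink n. g' x) = g' v + (\<Sum>x\<in>nonsink n - {v}. g' x)"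
    using v(1) by (simp_all add: sum.remove)
  moreover have "(\<Sum>x\<in>nonsink n - {v}. g' x) = (\<Sum>x\<in>nonsink n - {v}. g x)"
    by (rule sum.cong) (auto simp: g'_def)
  ultimately have "k = (\<Sum>x\<in>nonsink n. g' x)"
    using Suc.hyps(2) v(2) by (simp add: g'_def)
  moreover have "deg n x * g' x \<le> topple n v \<sigma> x" if x: "x \<in> nonsink n" for x
  proof (cases "x = v")
    case True
    have "int (topple n v \<sigma> v) = int (\<sigma> v) - int (deg n v)"
      using topple_apply[of n v \<sigma> v, OF legal v(1)] by (simp add: laplacian_diag)
    then show ?thesis
      using Suc.prems(2)[OF v(1)] True v(2) legal by (simp add: g'_def diff_mult_distrib2)
  next
    case False
    then show ?thesis
      using Suc.prems(2)[OF x] topple_mono_other[OF x False, of \<sigma>] by (simp add: g'_def)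
  qed
  ultimately have "(legal_topple n)\<^sup>*\<^sup>* (topple n v \<sigma>)
      (\<lambda>x\<in>nonsink n. nat (int (topple n v \<sigma> x) - lap n (\<lambda>v. int (g' v)) x))"
    using Suc.hyps(1)[of g' "topple n v \<sigma>"] by simp
  moreover have "(\<lambda>x\<in>nonsink n. nat (int (topple n v \<sigma> x) - lap n (\<lambda>v. int (g' v)) x)) =
      (\<lambda>x\<in>nonsink n. nat (int (\<sigma> x) - lap n (\<lambda>v. int (g v)) x))"
  proof (rule restrict_ext)
    fix x assume x: "x \<in> nonsink n"
    have "(\<lambda>y. int (g y)) = (\<lambda>y. int (g' y) + (if y = v then 1 else 0))"
      using v(2) by (auto simp: g'_def)
    then have "lap n (\<lambda>y. int (g y)) x = lap n (\<lambda>y. int (g' y)) x + laplacian n x v"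
      using lap_add lap_single[OF v(1)] by simp
    then show "nat (int (topple n v \<sigma> x) - lap n (\<lambda>v. int (g' v)) x) =
        nat (int (\<sigma> x) - lap n (\<lambda>v. int (g v)) x)"
      by (simp add: topple_apply[of n v \<sigma> x, OF legal x])
  qed
  moreover have "legal_topple n \<sigma> (topple n v \<sigma>)"
    using Suc.prems(1) v(1) legal by (auto simp: legal_topple_iff)
  ultimately show ?case
    by (simp add: converse_rtranclp_into_rtranclp)
qed

section \<open>Burning piles\<close>

text \<open>
The pile \<open>u - u\<degree>\<close> for \<open>u = deg\<close>. It represents the zero class and is positive at every vertex.
\<close>

definition burning_pile :: "nat \<Rightarrow> sandpile" where
  "burning_pile n = (\<lambda>x\<in>nonsink n. deg n x - stabilize n (\<lambda>x\<in>nonsink n. deg n x) x)"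

lemma burning_pile_pos: "x \<in> nonsink n \<Longrightarrow> burning_pile n x \<ge> 1"
  using stable_stabilize[of "\<lambda>x\<in>nonsink n. deg n x" n]
  by (auto simp: burning_pile_def stable_def Suc_le_eq)

text \<open>
Write \<open>\<zeta> = \<rho> + u\<close> with \<open>u = deg\<close>. In \<open>\<zeta> + \<epsilon> = (\<rho> + \<epsilon>) + u\<close> one may replace \<open>u\<close> by \<open>u\<degree>\<close> without
changing the stabilization, and \<open>\<epsilon> + u\<degree> = u\<close> gives back \<open>\<zeta>\<close>.
\<close>

lemma burning_pile_absorbed:
  assumes "\<zeta> \<in> sandpiles n" "\<And>x. x \<in> nonsink n \<Longrightarrow> deg n x \<le> \<zeta> x"
  shows "stabilize n (add_pile n \<zeta> (burning_pile n)) = stabilize n \<zeta>"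
proof -
  define u where "u = (\<lambda>x\<in>nonsink n. deg n x)"
  define \<rho> where "\<rho> = (\<lambda>x\<in>nonsink n. (\<zeta> x - deg n x) + burning_pile n x)"
  have u: "u \<in> sandpiles n"
    by (simp add: u_def)
  have small: "stabilize n u x < deg n x" if "x \<in> nonsink n" for x
    using stable_stabilize[OF u] that by (simp add: stable_def)
  have "add_pile n \<zeta> (burning_pile n) = add_pile n u \<rho>"
  proof (rule sandpile_eqI[of _ n])
    fix x assume x: "x \<in> nonsink n"
    then show "add_pile n \<zeta> (burning_pile n) x = add_pile n u \<rho> x"
      using assms(2)[OF x] by (simp add: u_def \<rho>_def)
  qed auto
  moreover have "add_pile n (stabilize n u) \<rho> = \<zeta>"
  proof (rule sandpile_eqI[of _ n])
    fix x assume x: "x \<in> nonsink n"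
    then show "add_pile n (stabilize n u) \<rho> x = \<zeta> x"
      using assms(2)[OF x] small[OF x] by (simp add: \<rho>_def burning_pile_def flip: u_def)
  qed (use assms(1) in auto)
  ultimately show ?thesis
    using stabilize_add[OF u, of \<rho>] by simp
qed

text \<open>
These states turn out to be the recurrent ones; they are easier to handle because the condition
involves a single fixed pile and no probability.
\<close>

definition burning_invariant :: "nat \<Rightarrow> sandpile set" where
  "burning_invariant n =
    {\<eta>. stable n \<eta> \<and> stabilize n (add_pile n \<eta> (burning_pile n)) = \<eta>}"

lemma burning_invariant_stable: "\<eta> \<in> burning_invariant n \<Longrightarrow> stable n \<eta>"
  by (simp add: burning_invariant_def)

lemma stabilize_add_multiple:
  assumes "stable n \<eta>" "stabilize n (add_pile n \<eta> \<gamma>) = \<eta>"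
  shows "stabilize n (add_pile n \<eta> (\<lambda>x. k * \<gamma> x)) = \<eta>"
proof (induction k)
  case 0
  have "add_pile n \<eta> (\<lambda>x. 0 * \<gamma> x) = \<eta>"
    by (rule sandpile_eqI[of _ n]) (use assms stable_sandpile in auto)
  then show ?case
    using assms by (simp add: stabilize_stable)
next
  case (Suc k)
  have "add_pile n \<eta> (\<lambda>x. Suc k * \<gamma> x) = add_pile n (add_pile n \<eta> (\<lambda>x. k * \<gamma> x)) \<gamma>"
    by (rule sandpile_eqI[of _ n]) auto
  then have "stabilize n (add_pile n \<eta> (\<lambda>x. Suc k * \<gamma> x)) =
      stabilize n (add_pile n (stabilize n (add_pile n \<eta> (\<lambda>x. k * \<gamma> x))) \<gamma>)"
    by (simp add: stabilize_add)
  with Suc.IH assms(2) show ?case by simp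
qed

lemma stabilize_large_burning_invariant:
  assumes "\<zeta> \<in> sandpiles n" "\<And>x. x \<in> nonsink n \<Longrightarrow> deg n x \<le> \<zeta> x"
  shows "stabilize n \<zeta> \<in> burning_invariant n"
  using stable_stabilize[OF assms(1)] burning_pile_absorbed[OF assms] stabilize_add[OF assms(1)]
  by (simp add: burning_invariant_def)

text \<open>
The constants divisible by 4 lie in the image of the Laplacian, so every class has representatives
that are as large as desired; stabilize one of them.
\<close>

lemma lap_equiv_burning_invariant_exists:
  "\<exists>\<eta>\<in>burning_invariant n. lap_equiv n (\<lambda>v. int (\<eta> v)) x"
proof -
  define k where "k = (\<Sum>v\<in>nonsink n. \<bar>x v\<bar> + int (deg n v))"
  \<comment> \<open>Adding \<open>4 k\<close> lifts every value of \<open>x\<close> above the degree.\<close>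
  have k: "\<bar>x v\<bar> + int (deg n v) \<le> k" if "v \<in> nonsink n" for v
    unfolding k_def using that by (intro member_le_sum) auto
  define \<zeta> where "\<zeta> = (\<lambda>v\<in>nonsink n. nat (x v + 4 * k))"
  have \<zeta>: "int (\<zeta> v) = x v + 4 * k \<and> deg n v \<le> \<zeta> v" if "v \<in> nonsink n" for v
  proof -
    have "int (deg n v) \<le> x v + 4 * k"
      using k[OF that] by linarith
    then show ?thesis
      using that by (simp add: \<zeta>_def)
  qed
  have \<zeta>_pile: "\<zeta> \<in> sandpiles n"
    by (simp add: \<zeta>_def)
  obtain f where "\<And>v. v \<in> nonsink n \<Longrightarrow> 4 * k = lap n f v"
    using four_times_lap_equiv_zero[of n "\<lambda>v. k"] unfolding lap_equiv_def by auto
  then have "lap_equiv n (\<lambda>v. int (\<zeta> v)) x"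
    unfolding lap_equiv_def by (intro exI[of _ f]) (simp add: \<zeta>)
  moreover have "lap_equiv n (\<lambda>v. int (stabilize n \<zeta> v)) (\<lambda>v. int (\<zeta> v))"
    by (rule lap_equiv_sym[OF stabilize_lap_equiv[OF \<zeta>_pile]])
  ultimately show ?thesis
    using stabilize_large_burning_invariant[OF \<zeta>_pile] \<zeta> lap_equiv_trans by blast
qed

text \<open>
Let \<open>\<eta> - \<theta> = \<Delta> (p - q)\<close> with \<open>p, q \<ge> 0\<close>. After adding a large multiple of the burning pile, which
does not change the stabilizations \<open>\<eta>\<close> and \<open>\<theta>\<close>, toppling according to \<open>p\<close> on one side and according
to \<open>q\<close> on the other side is legal and leads to the same pile.
\<close>

lemma lap_equiv_burning_invariant_unique:
  assumes "\<eta> \<in> burning_invariant n" "\<theta> \<in> burning_invariant n"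
    and "lap_equiv n (\<lambda>v. int (\<eta> v)) (\<lambda>v. int (\<theta> v))"
  shows "\<eta> = \<theta>"
proof -
  obtain f where f: "\<And>v. v \<in> nonsink n \<Longrightarrow> int (\<eta> v) - int (\<theta> v) = lap n f v"
    using assms(3) by (auto simp: lap_equiv_def)
  define p where "p v = nat (f v)" for v
  define q where "q v = nat (- f v)" for v
  have "f = (\<lambda>v. int (p v) - int (q v))"
    by (auto simp: p_def q_def)
  then have lap: "lap n f v = lap n (\<lambda>v. int (p v)) v - lap n (\<lambda>v. int (q v)) v" for v
    by (simp add: lap_diff)
  define k where "k = (\<Sum>v\<in>nonsink n. deg n v * (p v + q v))"
  define large where "large \<zeta> = add_pile n \<zeta> (\<lambda>v. k * burning_pile n v)" for \<zeta>
  have large: "deg n v * p v \<le> large \<zeta> v \<and> deg n v * q v \<le> large \<zeta> v" if v: "v \<in> nonsink n" for v \<zeta>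
  proof -
    have "deg n v * p v + deg n v * q v \<le> k"
      unfolding k_def distrib_left[symmetric] using v by (intro member_le_sum) auto
    also have "k \<le> k * burning_pile n v"
      using burning_pile_pos[OF v] by simp
    also have "\<dots> \<le> large \<zeta> v"
      using v by (simp add: large_def)
    finally show ?thesis by simp
  qed
  have pile: "large \<zeta> \<in> sandpiles n" for \<zeta>
    by (simp add: large_def)
  have "\<eta> = stabilize n (large \<eta>)"
    using assms(1) stabilize_add_multiple by (simp add: burning_invariant_def large_def)
  also have "\<dots> = stabilize n (\<lambda>x\<in>nonsink n. nat (int (large \<eta> x) - lap n (\<lambda>v. int (p v)) x))"
    by (intro stabilize_topplings legal_multiple_toppling) (use large pile in auto)
  also have "(\<lambda>x\<in>nonsink n. nat (int (large \<eta> x) - lap n (\<lambda>v. int (p v)) x)) =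
      (\<lambda>x\<in>nonsink n. nat (int (large \<theta> x) - lap n (\<lambda>v. int (q v)) x))"
  proof (rule restrict_ext)
    fix x assume x: "x \<in> nonsink n"
    show "nat (int (large \<eta> x) - lap n (\<lambda>v. int (p v)) x) =
        nat (int (large \<theta> x) - lap n (\<lambda>v. int (q v)) x)"
      using f[OF x] x by (intro arg_cong[of _ _ nat]) (simp add: large_def lap)
  qed
  also have "stabilize n \<dots> = stabilize n (large \<theta>)"
    by (intro stabilize_topplings[symmetric] legal_multiple_toppling) (use large pile in auto)
  also have "\<dots> = \<theta>"
    using assms(2) stabilize_add_multiple by (simp add: burning_invariant_def large_def)
  finally show ?thesis .
qed

section \<open>The recurrent states of the sandpile chain\<close>

definition drop_grain :: "nat \<Rightarrow> vertex \<Rightarrow> sandpile \<Rightarrow> sandpile" where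
  "drop_grain n v \<sigma> = stabilize n (add_pile n \<sigma> (delta_pile n v))"

lemma stable_drop_grain [simp]: "stable n (drop_grain n v \<sigma>)"
  by (simp add: drop_grain_def stable_stabilize)

lemma chain_Stream: "chain n \<sigma> (v ## Y) (Suc k) = chain n (drop_grain n v \<sigma>) Y k"
  by (induction k) (simp_all add: drop_grain_def)

lemma chain_eq_stabilize:
  assumes "stable n \<sigma>"
  shows "\<exists>\<zeta>. chain n \<sigma> Y k = stabilize n (add_pile n \<sigma> \<zeta>)"
proof (induction k)
  case 0
  have "\<sigma> = stabilize n (add_pile n \<sigma> (\<lambda>x. 0))"
    using stabilize_add_multiple[of n \<sigma> "\<lambda>x. 0" 0] stabilize_stable[OF assms]
      sandpile_eqI[of "add_pile n \<sigma> (\<lambda>x. 0)" n \<sigma>] stable_sandpile[OF assms] by simp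
  then show ?case by auto
next
  case (Suc k)
  then obtain \<zeta> where "chain n \<sigma> Y k = stabilize n (add_pile n \<sigma> \<zeta>)"
    by blast
  then have "chain n \<sigma> Y (Suc k) = stabilize n (add_pile n \<sigma> (add_pile n \<zeta> (delta_pile n (Y !! k))))"
    by (simp add: stabilize_add add_pile_assoc)
  then show ?case by blast
qed

lemma ex_hit_Stream:
  "(\<exists>k\<ge>1. chain n \<sigma> (v ## Y) k = \<eta>) \<longleftrightarrow>
    drop_grain n v \<sigma> = \<eta> \<or> (\<exists>k\<ge>1. chain n (drop_grain n v \<sigma>) Y k = \<eta>)" (is "?L \<longleftrightarrow> ?R")
proof -
  have "?L \<longleftrightarrow> (\<exists>k. chain n \<sigma> (v ## Y) (Suc k) = \<eta>)"
    by (auto simp: Suc_le_eq gr0_conv_Suc simp del: chain.simps)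
  also have "\<dots> \<longleftrightarrow> ?R"
    unfolding chain_Stream by (metis chain.simps(1) less_one not_le)
  finally show ?thesis .
qed

text \<open>
The type of sandpiles is uncountable, but the first grain has countably many values; splitting
along it lets the induction proceed from the front of the stream.
\<close>

lemma measurable_chain:
  "(\<lambda>Y. chain n \<sigma> Y k) \<in> measurable (stream_space (count_space UNIV)) (count_space UNIV)"
proof (induction k arbitrary: \<sigma>)
  case (Suc k)
  have eq: "chain n \<sigma> Y (Suc k) = chain n (drop_grain n (shd Y) \<sigma>) (stl Y) k" for Y
    using chain_Stream[of n \<sigma> "shd Y" "stl Y" k] by (simp only: stream.collapse)
  show ?case
    unfolding eq
    by (rule measurable_compose_countable[where f = "\<lambda>v Y. chain n (drop_grain n v \<sigma>) (stl Y) k"])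
      (use measurable_compose[OF measurable_stl Suc.IH] measurable_shd in auto)
qed simp

lemma sets_grains: "sets (grains n) = sets (stream_space (count_space UNIV))"
  unfolding grains_def by (rule sets_stream_space_cong) simp

lemma space_grains [simp]: "space (grains n) = UNIV"
  by (simp add: grains_def space_stream_space)

lemma prob_space_grains: "prob_space (grains n)"
  unfolding grains_def by (rule prob_space.prob_space_stream_space) (rule measure_pmf.prob_space_axioms)

lemma hit_event: "{Y. \<exists>k\<ge>1. chain n \<sigma> Y k = \<eta>} \<in> sets (grains n)"
proof -
  have "(\<lambda>Y. chain n \<sigma> Y k) \<in> measurable (grains n) (count_space UNIV)" for k
    using measurable_chain measurable_cong_sets[OF sets_grains refl] by blast
  from measurable_sets[OF this, of "{\<eta>}"]
  have "(\<Union>k\<in>{1..}. (\<lambda>Y. chain n \<sigma> Y k) -` {\<eta>}) \<in> sets (grains n)"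
    by (intro sets.countable_UN'') simp_all
  moreover have "(\<Union>k\<in>{1..}. (\<lambda>Y. chain n \<sigma> Y k) -` {\<eta>}) = {Y. \<exists>k\<ge>1. chain n \<sigma> Y k = \<eta>}"
    by auto
  ultimately show ?thesis by simp
qed

lemma pred_hit: "Measurable.pred (grains n) (\<lambda>Y. \<exists>k\<ge>1. chain n \<sigma> Y k = \<eta>)"
  using hit_event[of n \<sigma> \<eta>] by (simp add: pred_def)

lemma miss_event: "{Y. \<not> (\<exists>k\<ge>1. chain n \<sigma> Y k = \<eta>)} \<in> sets (grains n)"
proof -
  have "{Y. \<not> (\<exists>k\<ge>1. chain n \<sigma> Y k = \<eta>)} = space (grains n) - {Y. \<exists>k\<ge>1. chain n \<sigma> Y k = \<eta>}"
    by auto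
  then show ?thesis
    using sets.compl_sets[OF hit_event[of n \<sigma> \<eta>]] by simp
qed

text \<open>
Conditioning on the first grain \<open>v\<close> shows that the chain returns to \<open>\<eta>\<close> after \<open>v\<close> was added.
Collecting the grains of such a return gives a pile \<open>\<zeta>\<^sub>v\<close> with \<open>\<zeta>\<^sub>v(v) \<ge> 1\<close> and \<open>(\<eta> + \<zeta>\<^sub>v)\<degree> = \<eta>\<close>. The sum
of the \<open>\<zeta>\<^sub>v\<close> is positive everywhere and may be added any number of times, so \<open>\<eta>\<close> is the stabilization
of a large pile, and such stabilizations are invariant under the burning pile.
\<close>

lemma recurrent_subset: "recurrent n \<subseteq> burning_invariant n"
proof
  fix \<eta> assume "\<eta> \<in> recurrent n"
  then have stable: "stable n \<eta>" and AE: "AE Y in grains n. \<exists>k\<ge>1. chain n \<eta> Y k = \<eta>"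
    by (auto simp: recurrent_def)
  interpret grains: prob_space "grains n"
    by (rule prob_space_grains)
  have "\<exists>\<zeta>. \<zeta> v \<ge> 1 \<and> stabilize n (add_pile n \<eta> \<zeta>) = \<eta>" if v: "v \<in> nonsink n" for v
  proof -
    have "AE Y in grains n. \<exists>k\<ge>1. chain n \<eta> (v ## Y) k = \<eta>"
      using AE v nonsink_nonempty[of n]
        prob_space.AE_stream_space[OF measure_pmf.prob_space_axioms
          pred_hit[of n \<eta> \<eta>, unfolded grains_def], folded grains_def]
      by (simp add: AE_measure_pmf_iff)
    from eventually_happens'[OF grains.ae_filter_bot this]
    obtain Y k where "k \<ge> 1" "chain n \<eta> (v ## Y) k = \<eta>"
      by auto
    then obtain j where "chain n (drop_grain n v \<eta>) Y j = \<eta>"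
      using chain_Stream by (metis One_nat_def Suc_le_D)
    then obtain \<zeta> where "\<eta> = stabilize n (add_pile n (drop_grain n v \<eta>) \<zeta>)"
      using chain_eq_stabilize[of n "drop_grain n v \<eta>" Y j] by auto
    then have "stabilize n (add_pile n \<eta> (add_pile n (delta_pile n v) \<zeta>)) = \<eta>"
      by (simp add: drop_grain_def stabilize_add add_pile_assoc)
    moreover have "add_pile n (delta_pile n v) \<zeta> v \<ge> 1"
      using v by (simp add: delta_pile_def)
    ultimately show ?thesis by blast
  qed
  then obtain \<zeta> where \<zeta>: "\<And>v. v \<in> nonsink n \<Longrightarrow> \<zeta> v v \<ge> 1"
    "\<And>v. v \<in> nonsink n \<Longrightarrow> stabilize n (add_pile n \<eta> (\<zeta> v)) = \<eta>"
    by metis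
  have "stabilize n (add_pile n \<eta> (\<lambda>x. \<Sum>v\<in>A. \<zeta> v x)) = \<eta>" if "finite A" "A \<subseteq> nonsink n" for A
    using that
  proof (induction A rule: finite_induct)
    case empty
    have "add_pile n \<eta> (\<lambda>x. 0) = \<eta>"
      by (rule sandpile_eqI[of _ n]) (use stable_sandpile[OF stable] in auto)
    then show ?case by (simp add: stabilize_stable[OF stable])
  next
    case (insert v A)
    have "add_pile n \<eta> (\<lambda>x. \<Sum>v\<in>insert v A. \<zeta> v x) =
        add_pile n (add_pile n \<eta> (\<lambda>x. \<Sum>v\<in>A. \<zeta> v x)) (\<zeta> v)"
      by (rule sandpile_eqI[of _ n]) (use insert.hyps in auto)
    then have "stabilize n (add_pile n \<eta> (\<lambda>x. \<Sum>v\<in>insert v A. \<zeta> v x)) =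
        stabilize n (add_pile n (stabilize n (add_pile n \<eta> (\<lambda>x. \<Sum>v\<in>A. \<zeta> v x))) (\<zeta> v))"
      by (simp add: stabilize_add)
    then show ?case
      using insert \<zeta>(2) by simp
  qed
  from this[OF finite_nonsink order_refl]
  have inv: "stabilize n (add_pile n \<eta> (\<lambda>x. \<Sum>v\<in>nonsink n. \<zeta> v x)) = \<eta>" .
  define k where "k = (\<Sum>v\<in>nonsink n. deg n v)"
  define \<xi> where "\<xi> = add_pile n \<eta> (\<lambda>x. k * (\<Sum>v\<in>nonsink n. \<zeta> v x))"
  have "deg n x \<le> \<xi> x" if x: "x \<in> nonsink n" for x
  proof -
    have "1 \<le> \<zeta> x x"
      using \<zeta>(1)[OF x] .
    also have "\<dots> \<le> (\<Sum>v\<in>nonsink n. \<zeta> v x)"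
      using x by (intro member_le_sum) auto
    finally have one: "1 \<le> (\<Sum>v\<in>nonsink n. \<zeta> v x)" .
    have "deg n x \<le> k"
      unfolding k_def using x by (intro member_le_sum) auto
    also have "k \<le> k * (\<Sum>v\<in>nonsink n. \<zeta> v x)"
      using one by simp
    also have "\<dots> \<le> \<xi> x"
      using x by (simp add: \<xi>_def)
    finally show ?thesis .
  qed
  then have "stabilize n \<xi> \<in> burning_invariant n"
    by (intro stabilize_large_burning_invariant) (auto simp: \<xi>_def)
  moreover have "stabilize n \<xi> = \<eta>"
    unfolding \<xi>_def by (rule stabilize_add_multiple[OF stable inv])
  ultimately show "\<eta> \<in> burning_invariant n" by simp
qed

lemma finite_stable: "finite {\<sigma>. stable n \<sigma>}"
proof (rule finite_subset)
  show "{\<sigma>. stable n \<sigma>} \<subseteq> (\<Pi>\<^sub>E x\<in>nonsink n. {..<deg n x})"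
    by (auto simp: stable_def sandpiles_def intro!: PiE_I dest: PiE_arb)
qed (auto intro: finite_PiE)

text \<open>
A large multiple \<open>k \<epsilon>\<close> of the burning pile makes \<open>\<eta> + k \<epsilon>\<close> exceed \<open>\<sigma>\<close> everywhere, and \<open>\<eta> + k \<epsilon>\<close>
stabilizes to \<open>\<eta>\<close>. The pile \<open>\<zeta>\<close> is made positive so that at least one grain is dropped.
\<close>

lemma burning_invariant_reachable:
  assumes "\<eta> \<in> burning_invariant n" "\<sigma> \<in> sandpiles n"
  shows "\<exists>\<zeta>\<in>sandpiles n. (\<forall>x\<in>nonsink n. \<zeta> x \<ge> 1) \<and> stabilize n (add_pile n \<sigma> \<zeta>) = \<eta>"
proof -
  define k where "k = Suc (\<Sum>x\<in>nonsink n. \<sigma> x)"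
  define \<zeta> where "\<zeta> = (\<lambda>x\<in>nonsink n. \<eta> x + k * burning_pile n x - \<sigma> x)"
  have large: "Suc (\<sigma> x) \<le> k * burning_pile n x" if x: "x \<in> nonsink n" for x
  proof -
    have "Suc (\<sigma> x) \<le> k"
      unfolding k_def using x by (simp add: member_le_sum)
    also have "k \<le> k * burning_pile n x"
      using burning_pile_pos[OF x] by simp
    finally show ?thesis .
  qed
  have "add_pile n \<sigma> \<zeta> = add_pile n \<eta> (\<lambda>x. k * burning_pile n x)"
  proof (rule sandpile_eqI[of _ n])
    fix x assume x: "x \<in> nonsink n"
    then show "add_pile n \<sigma> \<zeta> x = add_pile n \<eta> (\<lambda>x. k * burning_pile n x) x"
      using large[OF x] by (simp add: \<zeta>_def)
  qed auto
  then have "stabilize n (add_pile n \<sigma> \<zeta>) = \<eta>"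
    using stabilize_add_multiple assms(1) by (simp add: burning_invariant_def)
  moreover have "\<zeta> x \<ge> 1" if x: "x \<in> nonsink n" for x
    using large[OF x] x by (simp add: \<zeta>_def)
  moreover have "\<zeta> \<in> sandpiles n"
    by (simp add: \<zeta>_def)
  ultimately show ?thesis by blast
qed

definition miss_prob :: "nat \<Rightarrow> sandpile \<Rightarrow> sandpile \<Rightarrow> real" where
  "miss_prob n \<eta> \<sigma> = measure (grains n) {Y. \<not> (\<exists>k\<ge>1. chain n \<sigma> Y k = \<eta>)}"

text \<open>
The Markov property at the first step: the probability of missing \<open>\<eta>\<close> is the average over the first
grain, where a first step into \<open>\<eta>\<close> itself contributes nothing.
\<close>

lemma miss_prob_step:
  "real (card (nonsink n)) * miss_prob n \<eta> \<sigma> =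
    (\<Sum>v\<in>nonsink n. if drop_grain n v \<sigma> = \<eta> then 0 else miss_prob n \<eta> (drop_grain n v \<sigma>))"
    (is "_ = (\<Sum>v\<in>_. ?g v)")
proof -
  let ?p = "pmf_of_set (nonsink n)"
  have "ennreal (miss_prob n \<eta> \<sigma>) = (\<integral>\<^sup>+v. measure (grains n) {Y. \<not> (\<exists>k\<ge>1. chain n \<sigma> (v ## Y) k = \<eta>)} \<partial>?p)"
    using prob_space.prob_stream_space[OF measure_pmf.prob_space_axioms,
        of ?p "\<lambda>Y. \<not> (\<exists>k\<ge>1. chain n \<sigma> Y k = \<eta>)", folded grains_def]
      miss_event[of n \<sigma> \<eta>]
    unfolding miss_prob_def by simp
  also have "\<dots> = (\<integral>\<^sup>+v. ennreal (?g v) \<partial>?p)"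
    unfolding ex_hit_Stream by (intro nn_integral_cong) (simp add: miss_prob_def)
  also have "\<dots> = ennreal (\<integral>v. ?g v \<partial>?p)"
    by (rule nn_integral_eq_integral)
      (auto simp: nonsink_nonempty miss_prob_def intro!: integrable_measure_pmf_finite)
  also have "(\<integral>v. ?g v \<partial>?p) = (\<Sum>v\<in>nonsink n. ?g v) / card (nonsink n)"
    by (rule integral_pmf_of_set) (auto simp: nonsink_nonempty)
  finally have "miss_prob n \<eta> \<sigma> = (\<Sum>v\<in>nonsink n. ?g v) / card (nonsink n)"
    by (subst (asm) ennreal_inj) (auto simp: miss_prob_def intro!: divide_nonneg_nonneg sum_nonneg)
  then show ?thesis
    using nonsink_nonempty[of n] by (simp add: field_simps)
qed

text \<open>
Maximum principle: if the maximum \<open>m\<close> of the missing probability over the finitely many stable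
states were positive, the averaging identity would force every successor of a maximizer to be a
maximizer different from \<open>\<eta>\<close>. But \<open>\<eta>\<close> is reachable from every stable state by dropping grains.
\<close>

lemma miss_prob_burning_invariant:
  assumes \<eta>: "\<eta> \<in> burning_invariant n" and "stable n \<sigma>"
  shows "miss_prob n \<eta> \<sigma> = 0"
proof -
  define m where "m = Max (miss_prob n \<eta> ` {\<sigma>. stable n \<sigma>})"
  have le: "miss_prob n \<eta> \<sigma> \<le> m" if "stable n \<sigma>" for \<sigma>
    unfolding m_def using finite_stable that by (intro Max_ge) auto
  have "m \<in> miss_prob n \<eta> ` {\<sigma>. stable n \<sigma>}"
    unfolding m_def using finite_stable assms(2) by (intro Max_in) auto
  then obtain \<sigma>0 where \<sigma>0: "stable n \<sigma>0" "miss_prob n \<eta> \<sigma>0 = m"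
    by auto
  have "m \<le> 0"
  proof (rule ccontr)
    assume "\<not> m \<le> 0"
    then have pos: "m > 0" by simp
    have step: "drop_grain n v \<tau> \<noteq> \<eta> \<and> miss_prob n \<eta> (drop_grain n v \<tau>) = m"
      if \<tau>: "miss_prob n \<eta> \<tau> = m" and v: "v \<in> nonsink n" for \<tau> v
    proof (rule ccontr)
      let ?g = "\<lambda>v. if drop_grain n v \<tau> = \<eta> then 0 else miss_prob n \<eta> (drop_grain n v \<tau>)"
      assume "\<not> ?thesis"
      then have "?g v < m"
        using pos le[of "drop_grain n v \<tau>"] by auto
      moreover have "?g w \<le> m" for w
        using pos le[of "drop_grain n w \<tau>"] by auto
      ultimately have "(\<Sum>w\<in>nonsink n. ?g w) < (\<Sum>w\<in>nonsink n. m)"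
        using v by (intro sum_strict_mono_ex1) (simp, blast, blast)
      then show False
        using miss_prob_step[of n \<eta> \<tau>] \<tau> by simp
    qed
    have never: "stabilize n (add_pile n \<tau> \<zeta>) \<noteq> \<eta>"
      if "\<tau> \<in> sandpiles n" "miss_prob n \<eta> \<tau> = m" "(\<Sum>x\<in>nonsink n. \<zeta> x) = Suc k" for \<tau> \<zeta> k
      using that
    proof (induction k arbitrary: \<tau> \<zeta>)
      case 0
      then have "\<exists>v\<in>nonsink n. \<zeta> v = 1 \<and> (\<forall>x\<in>nonsink n. v \<noteq> x \<longrightarrow> \<zeta> x = 0)"
        by (subst sum_eq_1_iff[symmetric]) simp_all
      then obtain v where v: "v \<in> nonsink n"
        "\<zeta> v = 1 \<and> (\<forall>x\<in>nonsink n. v \<noteq> x \<longrightarrow> \<zeta> x = 0)"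
        by (rule bexE)
      have "add_pile n \<tau> \<zeta> = add_pile n \<tau> (delta_pile n v)"
      proof (rule sandpile_eqI[of _ n])
        fix x assume "x \<in> nonsink n"
        then show "add_pile n \<tau> \<zeta> x = add_pile n \<tau> (delta_pile n v) x"
          using v by (cases "x = v") (simp_all add: delta_pile_def)
      qed auto
      then show ?case
        using step[OF 0(2) v(1)] by (simp add: drop_grain_def)
    next
      case (Suc k)
      then obtain v where v: "v \<in> nonsink n" "\<zeta> v > 0"
        by (metis bot_nat_0.not_eq_extremum nat.distinct(1) sum.neutral)
      define \<xi> where "\<xi> = \<zeta>(v := \<zeta> v - 1)"
      have "add_pile n \<tau> \<zeta> = add_pile n (add_pile n \<tau> (delta_pile n v)) \<xi>"
      proof (rule sandpile_eqI[of _ n])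
        fix x assume "x \<in> nonsink n"
        then show "add_pile n \<tau> \<zeta> x = add_pile n (add_pile n \<tau> (delta_pile n v)) \<xi> x"
          using v by (cases "x = v") (simp_all add: \<xi>_def delta_pile_def)
      qed auto
      then have "stabilize n (add_pile n \<tau> \<zeta>) = stabilize n (add_pile n (drop_grain n v \<tau>) \<xi>)"
        by (simp add: drop_grain_def stabilize_add)
      moreover have "(\<Sum>x\<in>nonsink n. \<xi> x) = Suc k"
      proof -
        have "(\<Sum>x\<in>nonsink n - {v}. \<xi> x) = (\<Sum>x\<in>nonsink n - {v}. \<zeta> x)"
          by (rule sum.cong) (auto simp: \<xi>_def)
        then show ?thesis
          using Suc.prems(3) v by (simp add: sum.remove \<xi>_def)
      qed
      ultimately show ?case
        using Suc.IH[of "drop_grain n v \<tau>" \<xi>] step[OF Suc.prems(2) v(1)] stable_sandpile by simp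
    qed
    obtain \<zeta> where \<zeta>: "\<zeta> \<in> sandpiles n" "\<And>x. x \<in> nonsink n \<Longrightarrow> \<zeta> x \<ge> 1"
      "stabilize n (add_pile n \<sigma>0 \<zeta>) = \<eta>"
      using burning_invariant_reachable[OF \<eta>] \<sigma>0(1) stable_sandpile by metis
    have "(\<Sum>x\<in>nonsink n. \<zeta> x) \<noteq> 0"
      using \<zeta>(2) nonsink_nonempty[of n] by (auto simp: Suc_le_eq)
    then obtain k where "(\<Sum>x\<in>nonsink n. \<zeta> x) = Suc k"
      using not0_implies_Suc by blast
    then show False
      using never[of \<sigma>0 \<zeta> k] \<sigma>0 \<zeta>(3) stable_sandpile by simp
  qed
  then show ?thesis
    using le[OF assms(2)] measure_nonneg[of "grains n"] by (simp add: miss_prob_def order_antisym)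
qed

theorem recurrent_eq_burning_invariant: "recurrent n = burning_invariant n"
proof (rule equalityI[OF recurrent_subset], rule subsetI)
  fix \<eta> assume \<eta>: "\<eta> \<in> burning_invariant n"
  interpret grains: prob_space "grains n"
    by (rule prob_space_grains)
  have "AE Y in grains n. \<not> \<not> (\<exists>k\<ge>1. chain n \<eta> Y k = \<eta>)"
    using miss_prob_burning_invariant[OF \<eta> burning_invariant_stable[OF \<eta>]] miss_event[of n \<eta> \<eta>]
      grains.prob_Collect_eq_0[of "\<lambda>Y. \<not> (\<exists>k\<ge>1. chain n \<eta> Y k = \<eta>)"]
    by (simp add: miss_prob_def)
  then show "\<eta> \<in> recurrent n"
    using burning_invariant_stable[OF \<eta>] by (simp add: recurrent_def)
qed

section \<open>The sandpile group\<close>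

lemma carrier_config_group [simp]: "carrier (config_group n) = (nonsink n \<rightarrow>\<^sub>E UNIV)"
  by (simp add: config_group_def integer_group_def)

lemma comm_group_config_group: "comm_group (config_group n)"
proof (rule group.group_comm_groupI)
  show "group (config_group n)"
    by (simp add: config_group_def)
  show "x \<otimes>\<^bsub>config_group n\<^esub> y = y \<otimes>\<^bsub>config_group n\<^esub> x" for x y
    by (simp add: config_group_def add.commute)
qed

lemma config_group_pow:
  assumes "x \<in> carrier (config_group n)"
  shows "x [^]\<^bsub>config_group n\<^esub> (k :: nat) = (\<lambda>v\<in>nonsink n. int k * x v)"
proof (induction k)
  case 0
  show ?case by (simp add: config_group_def)
next
  case (Suc k)
  then show ?case
    by (auto simp: config_group_def algebra_simps restrict_def)
qed

lemma laplacian_image_iff: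
  "x \<in> laplacian_image n \<longleftrightarrow> x \<in> carrier (config_group n) \<and> lap_equiv n x (\<lambda>v. 0)"
proof
  assume "x \<in> laplacian_image n"
  then show "x \<in> carrier (config_group n) \<and> lap_equiv n x (\<lambda>v. 0)"
    by (auto simp: laplacian_image_def lap_equiv_def lap_def simp del: split_paired_Ex)
next
  assume x: "x \<in> carrier (config_group n) \<and> lap_equiv n x (\<lambda>v. 0)"
  then obtain f where f: "\<And>v. v \<in> nonsink n \<Longrightarrow> x v = lap n f v"
    by (auto simp: lap_equiv_def)
  have "x = (\<lambda>v\<in>nonsink n. \<Sum>y\<in>nonsink n. laplacian n v y * restrict f (nonsink n) y)"
    by (rule PiE_ext[of _ "nonsink n" "\<lambda>v. UNIV"]) (use x f in \<open>simp_all add: lap_def\<close>)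
  then show "x \<in> laplacian_image n"
    unfolding laplacian_image_def by (intro image_eqI[of _ _ "restrict f (nonsink n)"]) simp_all
qed

lemma normal_laplacian_image: "laplacian_image n \<lhd> config_group n"
proof -
  interpret comm_group "config_group n"
    by (rule comm_group_config_group)
  have "subgroup (laplacian_image n) (config_group n)"
  proof (rule subgroupI)
    have "\<one>\<^bsub>config_group n\<^esub> \<in> laplacian_image n"
      unfolding laplacian_image_iff by (auto intro!: lap_equiv_refl simp: config_group_def)
    then show "laplacian_image n \<noteq> {}" by blast
  next
    fix x assume x: "x \<in> laplacian_image n"
    then have "inv\<^bsub>config_group n\<^esub> x = (\<lambda>v\<in>nonsink n. - x v)"
      unfolding config_group_def
      by (subst inv_product_group) (auto simp: laplacian_image_iff config_group_def)
    moreover obtain f where "\<And>v. v \<in> nonsink n \<Longrightarrow> x v = lap n f v"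
      using x by (auto simp: laplacian_image_iff lap_equiv_def)
    then have "lap_equiv n (\<lambda>v\<in>nonsink n. - x v) (\<lambda>v. 0)"
      unfolding lap_equiv_def
      by (intro exI[of _ "\<lambda>v. - f v"]) (simp add: lap_def sum_negf)
    ultimately show "inv\<^bsub>config_group n\<^esub> x \<in> laplacian_image n"
      by (simp add: laplacian_image_iff)
  next
    fix x y assume xy: "x \<in> laplacian_image n" "y \<in> laplacian_image n"
    then obtain f g where "\<And>v. v \<in> nonsink n \<Longrightarrow> x v = lap n f v"
      "\<And>v. v \<in> nonsink n \<Longrightarrow> y v = lap n g v"
      by (auto simp: laplacian_image_iff lap_equiv_def)
    then have "lap_equiv n (\<lambda>v\<in>nonsink n. x v + y v) (\<lambda>v. 0)"
      unfolding lap_equiv_def by (intro exI[of _ "\<lambda>v. f v + g v"]) (simp add: lap_add)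
    then show "x \<otimes>\<^bsub>config_group n\<^esub> y \<in> laplacian_image n"
      by (simp add: laplacian_image_iff) (simp add: config_group_def)
  qed (auto simp: laplacian_image_iff)
  then show ?thesis
    by (rule subgroup_imp_normal)
qed

text \<open>
The class group has exponent dividing 4, so the order of an element divides 4, and it is 1 only for
the identity.
\<close>

lemma ord_sandpile_class:
  assumes "sandpile_class n \<eta> \<noteq> \<one>\<^bsub>class_group n\<^esub>"
  shows "group.ord (class_group n) (sandpile_class n \<eta>) \<in> {2, 4}"
proof -
  interpret normal "laplacian_image n" "config_group n"
    by (rule normal_laplacian_image)
  interpret Q: group "class_group n"
    unfolding class_group_def by (rule factorgroup_is_group)
  define c where "c = (\<lambda>v\<in>nonsink n. int (\<eta> v))"
  have c: "c \<in> carrier (config_group n)"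
    by (simp add: c_def)
  have coset: "sandpile_class n \<eta> = laplacian_image n #>\<^bsub>config_group n\<^esub> c"
    by (simp add: sandpile_class_def c_def)
  have carrier: "sandpile_class n \<eta> \<in> carrier (class_group n)"
    unfolding coset class_group_def carrier_FactGroup using c by blast
  have "lap_equiv n (\<lambda>v\<in>nonsink n. 4 * c v) (\<lambda>v. 0)"
    by (rule lap_equiv_trans[OF lap_equiv_refl four_times_lap_equiv_zero[of n c]]) simp
  then have "c [^]\<^bsub>config_group n\<^esub> (4 :: nat) \<in> laplacian_image n"
    unfolding config_group_pow[OF c] laplacian_image_iff by simp
  then have "sandpile_class n \<eta> [^]\<^bsub>class_group n\<^esub> (4 :: nat) = \<one>\<^bsub>class_group n\<^esub>"
    unfolding coset class_group_def FactGroup_pow[OF c]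
    by (simp add: coset_join2 subgroup_axioms laplacian_image_iff)
  then have "Q.ord (sandpile_class n \<eta>) dvd 4"
    using Q.pow_eq_id[OF carrier] by simp
  moreover have "Q.ord (sandpile_class n \<eta>) \<noteq> 1"
    using Q.ord_eq_1[OF carrier] assms by simp
  moreover have "d \<in> {2, 4}" if "d dvd 4" "d \<noteq> 1" for d :: nat
  proof -
    have "d \<le> 4" using that(1) by (rule dvd_imp_le) simp
    then have "d \<in> {0, 1, 2, 3, 4}" by auto
    then show ?thesis using that by auto
  qed
  ultimately show ?thesis by blast
qed

text \<open>
The coordinates modulo 4 of a recurrent state give the isomorphism. Stabilizing changes a pile only
within its class, so they are additive; bijectivity says that every class contains exactly one
recurrent state.
\<close>

lemma sandpile_group_iso:
  "sandpile_group n \<cong> product_group {..<2 * 5 ^ n :: nat} (\<lambda>_. integer_mod_group 4)"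
proof -
  let ?I = "{..<2 * 5 ^ n :: nat}"
  let ?Z = "product_group ?I (\<lambda>_. integer_mod_group 4)"
  obtain F where F: "vicsek_coordinates n F"
    using vicsek_coordinates_exist by blast
  interpret mod4_coordinates "vicsek_sink n" "nonsink n" "vicsek_cells n" F
    by (rule F)
  note equiv_iff = lap_equiv_iff_coordinates[OF F]
  define \<Psi> where "\<Psi> \<eta> = (\<lambda>i\<in>?I. F (\<lambda>v. int (\<eta> v)) i mod 4)" for \<eta> :: sandpile
  have carrier: "carrier (sandpile_group n) = burning_invariant n"
    by (simp add: sandpile_group_def recurrent_eq_burning_invariant)
  have mult: "\<eta> \<otimes>\<^bsub>sandpile_group n\<^esub> \<zeta> = sandpile_add n \<eta> \<zeta>" for \<eta> \<zeta>
    by (simp add: sandpile_group_def)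
  have carrier_Z: "carrier ?Z = (\<Pi>\<^sub>E i\<in>?I. {0..<4})"
    by (simp add: carrier_integer_mod_group)
  have \<Psi>_eq: "\<Psi> \<eta> = \<Psi> \<zeta> \<longleftrightarrow> lap_equiv n (\<lambda>v. int (\<eta> v)) (\<lambda>v. int (\<zeta> v))" for \<eta> \<zeta>
    unfolding equiv_iff \<Psi>_def by (auto simp: fun_eq_iff restrict_def)
  have \<Psi>_carrier: "\<Psi> \<eta> \<in> carrier ?Z" for \<eta>
    unfolding carrier_Z by (auto simp: \<Psi>_def)
  have "\<Psi> \<in> hom (sandpile_group n) ?Z"
  proof (rule homI)
    fix \<eta> \<zeta> assume "\<eta> \<in> carrier (sandpile_group n)" "\<zeta> \<in> carrier (sandpile_group n)"
    have "\<Psi> (sandpile_add n \<eta> \<zeta>) = \<Psi> (add_pile n \<eta> \<zeta>)"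
      unfolding \<Psi>_eq sandpile_add_def by (rule lap_equiv_sym[OF stabilize_lap_equiv]) simp
    also have "\<dots> = \<Psi> \<eta> \<otimes>\<^bsub>?Z\<^esub> \<Psi> \<zeta>"
    proof -
      have "F (\<lambda>v. int (add_pile n \<eta> \<zeta> v)) i = F (\<lambda>v. int (\<eta> v) + int (\<zeta> v)) i" for i
        by (rule cong) simp
      then show ?thesis
        by (auto simp: \<Psi>_def add mod_add_eq restrict_def)
    qed
    finally show "\<Psi> (\<eta> \<otimes>\<^bsub>sandpile_group n\<^esub> \<zeta>) = \<Psi> \<eta> \<otimes>\<^bsub>?Z\<^esub> \<Psi> \<zeta>"
      by (simp only: mult)
  qed (rule \<Psi>_carrier)
  moreover have "bij_betw \<Psi> (carrier (sandpile_group n)) (carrier ?Z)"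
    unfolding bij_betw_def carrier
  proof
    show "inj_on \<Psi> (burning_invariant n)"
      by (rule inj_onI) (simp add: \<Psi>_eq lap_equiv_burning_invariant_unique)
    show "\<Psi> ` burning_invariant n = carrier ?Z"
    proof (intro equalityI subsetI)
      fix t assume t: "t \<in> carrier ?Z"
      obtain x where x: "\<And>i. i < 2 * 5 ^ n \<Longrightarrow> F x i = t i"
        using surj[of t] vicsek_clique_tree[of n] by auto
      obtain \<eta> where \<eta>: "\<eta> \<in> burning_invariant n" "lap_equiv n (\<lambda>v. int (\<eta> v)) x"
        using lap_equiv_burning_invariant_exists by blast
      have "\<Psi> \<eta> = t"
      proof (rule PiE_ext)
        show "\<Psi> \<eta> \<in> (\<Pi>\<^sub>E i\<in>?I. {0..<4})" "t \<in> (\<Pi>\<^sub>E i\<in>?I. {0..<4})"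
          using t \<Psi>_carrier carrier_Z by auto
        fix i assume i: "i \<in> ?I"
        have "t i \<in> {0..<4}"
          using t i carrier_Z by (auto dest: PiE_mem)
        then show "\<Psi> \<eta> i = t i"
          using \<eta>(2) i x unfolding equiv_iff by (simp add: \<Psi>_def)
      qed
      then show "t \<in> \<Psi> ` burning_invariant n"
        using \<eta>(1) by blast
    qed (use \<Psi>_carrier in auto)
  qed
  ultimately have "\<Psi> \<in> iso (sandpile_group n) ?Z"
    by (simp add: iso_def)
  then show ?thesis
    by (auto simp: is_iso_def)
qed

theorem theorem5p1:
  fixes n :: nat
  shows "(\<forall>\<eta>\<in>carrier (sandpile_group n).
            sandpile_class n \<eta> \<noteq> \<one>\<^bsub>class_group n\<^esub> \<longrightarrow>
            group.ord (class_group n) (sandpile_class n \<eta>) \<in> {2, 4}) \<and>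
         sandpile_group n \<cong> product_group {..<2 * 5 ^ n :: nat} (\<lambda>_. integer_mod_group 4)"
  using ord_sandpile_class sandpile_group_iso by blast

end
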